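(* Let $\theta_0\in\Theta$ be the true parameter and let $x_1,x_2,\ldots$ be i.i.d. observations from the true density $f(x;\theta_0)$. Suppose that the true model $f(x;\theta_0)$ cannot be represented by any model consisting of less than $M$ components, i.e. $f(\cdot;\theta_0)$ is not equal to a mixture of $M'$ uniform densities for any $M'<M$. Let $c_0>0$ and $0<d<1$. If $c_n=c_0\exp(-n^d)\le b_m$ is imposed for all $b_m$, i.e. the parameter is restricted to $$\Theta_n=\{\theta\in\Theta \mid 0<c_n\le b_m,\ m=1,\ldots,M\},$$ then the maximum likelihood estimator $\hat\theta_n$ (which is restricted to $\Theta_n$) is strongly consistent, that is, $$\mathrm{Prob}\Bigl(\lim_{n\to\infty}\ \inf_{\theta\in T_0}\mathrm{dist}(\hat\theta_n,\theta)=0\Bigr)=1 .$$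
   Context: For $b>0$, the uniform density on the half-open interval $[a-b,a+b)$ with parameter $\eta=(a,b)$ is $f_m(x;\eta)=f_m(x;a,b)=\frac{1}{2b}$ for $x\in[a-b,a+b)$ and $0$ otherwise. For $\theta=(\alpha_1,a_1,b_1,\ldots,\alpha_M,a_M,b_M)$ the mixture of $M$ uniform densities is $f(x;\theta)=\sum_{m=1}^M\alpha_m f_m(x;a_m,b_m)$. The parameter space is $$\Theta=\Bigl\{(\alpha_1,a_1,b_1,\ldots,\alpha_M,a_M,b_M)\in\mathbb{R}^{3M}\ \Big|\ 0\le\alpha_1,\ldots,\alpha_M\le1,\ \sum_{m=1}^M\alpha_m=1,\ b_1,\ldots,b_M>0\Bigr\}.$$ The set of true parameters is $T_0=\{\theta\in\Theta\mid f(x;\theta)=f(x;\theta_0)\ \text{for all }x\}$ (it may contain more than one point), and $\mathrm{dist}$ is Euclidean distance in $\mathbb{R}^{3M}$. The maximum likelihood estimator restricted to $\Theta_n$, based on the sample $x_1,\ldots,x_n$ of size $n$, is the estimator $\hat\theta_n=\hat\theta_n(x_1,\ldots,x_n)\in\Theta_n$ maximizing the likelihood $\prod_{i=1}^n f(x_i;\theta)$ over $\theta\in\Theta_n$. *)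

theory Defs
  imports "HOL-Probability.Probability"
begin

definition unif_density :: "real \<Rightarrow> real \<Rightarrow> real \<Rightarrow> real" where
  "unif_density a b x = (if x \<in> {a - b..<a + b} then 1 / (2 * b) else 0)"

text \<open>
  A component is a triple \<open>(\<alpha>, a, b)\<close>.  Mixtures are defined over an arbitrary index set \<open>I\<close>, so
  that models with different numbers of components can be compared.
\<close>

definition is_mixture_param :: "'i set \<Rightarrow> ('i \<Rightarrow> real \<times> real \<times> real) \<Rightarrow> bool" where
  "is_mixture_param I p \<longleftrightarrow>
     (\<forall>m\<in>I. case p m of (\<alpha>, a, b) \<Rightarrow> 0 \<le> \<alpha> \<and> \<alpha> \<le> 1 \<and> 0 < b) \<and>
     (\<Sum>m\<in>I. case p m of (\<alpha>, a, b) \<Rightarrow> \<alpha>) = 1"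

definition mixture :: "'i set \<Rightarrow> ('i \<Rightarrow> real \<times> real \<times> real) \<Rightarrow> real \<Rightarrow> real" where
  "mixture I p x = (\<Sum>m\<in>I. case p m of (\<alpha>, a, b) \<Rightarrow> \<alpha> * unif_density a b x)"

text \<open>
  With \<open>M = CARD('m)\<close>, the \<open>dist\<close> of this type is the Euclidean distance of \<open>\<real>\<^sup>3\<^sup>M\<close>: the metrics on
  products and on vectors are both \<open>L\<^sub>2\<close> combinations of the metrics of their components.
\<close>

type_synonym 'm params = "(real \<times> real \<times> real) ^ 'm"

definition Theta :: "'m::finite params set" where
  "Theta = {\<theta>. is_mixture_param UNIV (($) \<theta>)}"

definition mix_density :: "'m::finite params \<Rightarrow> real \<Rightarrow> real" where
  "mix_density \<theta> = mixture UNIV (($) \<theta>)"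

definition true_params :: "'m::finite params \<Rightarrow> 'm params set" where
  "true_params \<theta>\<^sub>0 = {\<theta> \<in> Theta. \<forall>x. mix_density \<theta> x = mix_density \<theta>\<^sub>0 x}"

definition Theta_ge :: "real \<Rightarrow> 'm::finite params set" where
  "Theta_ge c = {\<theta> \<in> Theta. \<forall>m. case \<theta> $ m of (\<alpha>, a, b) \<Rightarrow> 0 < c \<and> c \<le> b}"

definition scale_bound :: "real \<Rightarrow> real \<Rightarrow> nat \<Rightarrow> real" where
  "scale_bound c\<^sub>0 d n = c\<^sub>0 * exp (- (real n powr d))"

definition likelihood :: "nat \<Rightarrow> (nat \<Rightarrow> real) \<Rightarrow> 'm::finite params \<Rightarrow> real" where
  "likelihood n x \<theta> = (\<Prod>i<n. mix_density \<theta> (x i))"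

text \<open>
  Because the component intervals are half-open, the supremum of the likelihood over \<open>Theta_ge c\<close>
  is typically not attained: shortening an interval slightly at its right end keeps all the
  observations in it and raises the density there.  A maximizer is therefore allowed to reach the
  supremum only up to a factor \<open>\<kappa>\<close>.  For \<open>\<kappa> = 1\<close> it is an exact maximizer; for \<open>0 < \<kappa> < 1\<close> and
  \<open>0 < c\<close> one exists for every sample.
\<close>

definition is_mle_upto ::
    "real \<Rightarrow> 'm::finite params set \<Rightarrow> nat \<Rightarrow> (nat \<Rightarrow> real) \<Rightarrow> 'm params \<Rightarrow> bool" where
  "is_mle_upto \<kappa> S n x \<theta> \<longleftrightarrow>
     \<theta> \<in> S \<and> (\<forall>\<theta>'\<in>S. \<kappa> * likelihood n x \<theta>' \<le> likelihood n x \<theta>)"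

lemma is_mle_upto_1_iff:
  "is_mle_upto 1 S n x \<theta> \<longleftrightarrow> is_arg_max (likelihood n x) (\<lambda>\<theta>. \<theta> \<in> S) \<theta>"
  by (auto simp: is_mle_upto_def is_arg_max_def not_less)

end

theory Submission
  imports Defs
begin

text \<open>
  The likelihood of mixtures of uniform densities is unbounded, but only because components may
  become arbitrarily narrow.  The lower bound \<open>c\<^sub>n = c\<^sub>0 exp (- n\<^sup>d)\<close> on the half-widths still allows
  densities of exponential size, and the reason why it suffices is a count.  Up to a small error in
  \<open>L\<^sub>1\<close>, the densities with half-widths at least \<open>c\<close> are bounded, on a fixed bounded interval
  containing all the observations, by the members of a finite family of functions whose size is
  only polynomial in \<open>1 / c\<close> (\<open>mixture_brackets\<close>).  At the sample size \<open>n\<close> this size is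
  \<open>exp (O (n\<^sup>d))\<close>, which is subexponential because \<open>d < 1\<close>.
  
  Against this stands an exponential bound for a single function.  Write \<open>f\<^sub>0\<close> for the true density.
  If \<open>g\<close> has affinity \<open>\<integral> \<surd>(g f\<^sub>0) \<le> r < 1\<close> with it, then \<open>\<surd>(g / f\<^sub>0)\<close> has expectation at most \<open>r\<close>
  under \<open>f\<^sub>0\<close>.  By independence and Markov's inequality the likelihood ratio \<open>\<Prod> g (x\<^sub>i) / f\<^sub>0 (x\<^sub>i)\<close>
  reaches \<open>\<kappa>\<close> with probability at most \<open>r\<^sup>n / \<surd>\<kappa>\<close> (\<open>likelihood_ratio_tail\<close>).  This bound
  depends on \<open>g\<close> only through \<open>r\<close>, and so it covers narrow components with their high
  peaks.  Since \<open>exp (O (n\<^sup>d)) r\<^sup>n\<close> is summable, by the Borel-Cantelli lemma almost surely, for all large \<open>n\<close>, none of the members of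
  the \<open>n\<close>-th family with affinity at most \<open>r\<close> competes with the truth.  The same then holds for
  every density that they bound.
  
  It remains to see that parameters at distance at least \<open>\<epsilon>\<close> from the true ones have affinity
  bounded away from \<open>1\<close>, although neither the centres nor the half-widths are confined to a compact
  set (\<open>affinity_separation\<close>).  Otherwise there is a sequence of such parameters whose affinity tends
  to \<open>1\<close>.  Along a subsequence each component either converges to a proper component or degenerates:
  it becomes infinitely narrow, infinitely wide, or escapes to infinity.  The density of a
  degenerating component tends to \<open>0\<close> almost everywhere, so the densities converge almost everywhere
  to the mixture of the limits of the other components.  By Fatou's lemma for the Hellinger distance
  this mixture is \<open>f\<^sub>0\<close>.  As \<open>f\<^sub>0\<close> is not a mixture of fewer than \<open>M\<close> components, no component has
  degenerated, and the parameters converge to a true parameter, a contradiction.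
\<close>

section \<open>Uniform densities and their mixtures\<close>

lemma unif_density_nonneg: "0 < b \<Longrightarrow> 0 \<le> unif_density a b x"
  by (simp add: unif_density_def)

lemma unif_density_le: "0 < b \<Longrightarrow> unif_density a b x \<le> 1 / (2 * b)"
  by (simp add: unif_density_def)

lemma borel_measurable_unif_density [measurable]: "unif_density a b \<in> borel_measurable borel"
  unfolding unif_density_def by measurable

lemma has_bochner_integral_unif_density:
  assumes "0 < b"
  shows "has_bochner_integral lborel (unif_density a b) 1"
proof -
  have "has_bochner_integral lborel (\<lambda>x. 1 / (2 * b) * indicator {a - b..<a + b} x) (1 / (2 * b) * (2 * b))"
    using assms has_bochner_integral_real_indicator[of "{a - b..<a + b}" lborel]
    by (intro has_bochner_integral_mult_right) (auto simp: algebra_simps)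
  moreover have "(\<lambda>x. 1 / (2 * b) * indicator {a - b..<a + b} x) = unif_density a b"
    by (auto simp: unif_density_def indicator_def)
  ultimately show ?thesis
    using assms by simp
qed

lemma mixture_nonneg:
  assumes "is_mixture_param I p"
  shows "0 \<le> mixture I p x"
  using assms unfolding mixture_def is_mixture_param_def
  by (intro sum_nonneg) (force split: prod.splits intro!: mult_nonneg_nonneg unif_density_nonneg)

lemma borel_measurable_mixture [measurable]: "mixture I p \<in> borel_measurable borel"
  unfolding mixture_def by (auto split: prod.splits)

lemma has_bochner_integral_mixture:
  assumes "\<And>m. m \<in> I \<Longrightarrow> 0 < snd (snd (p m))"
  shows "has_bochner_integral lborel (mixture I p) (\<Sum>m\<in>I. case p m of (\<alpha>, a, b) \<Rightarrow> \<alpha>)"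
  unfolding mixture_def
proof (intro has_bochner_integral_sum)
  fix m assume "m \<in> I"
  then show "has_bochner_integral lborel (\<lambda>x. case p m of (\<alpha>, a, b) \<Rightarrow> \<alpha> * unif_density a b x)
      (case p m of (\<alpha>, a, b) \<Rightarrow> \<alpha>)"
    using has_bochner_integral_mult_right[OF has_bochner_integral_unif_density[of "snd (snd (p m))"],
        of "fst (p m)" "fst (snd (p m))"] assms[of m]
    by (simp add: split_beta)
qed

lemma Theta_D:
  assumes "\<theta> \<in> Theta" "\<theta> $ m = (\<alpha>, a, b)"
  shows "0 \<le> \<alpha>" "\<alpha> \<le> 1" "0 < b"
  using assms unfolding Theta_def is_mixture_param_def by (auto dest: spec[of _ m])

lemma Theta_pos: "\<theta> \<in> Theta \<Longrightarrow> 0 < snd (snd (\<theta> $ m))"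
  using Theta_D(3)[of \<theta> m] by (cases "\<theta> $ m") auto

lemma mix_density_nonneg: "\<theta> \<in> Theta \<Longrightarrow> 0 \<le> mix_density \<theta> x"
  by (simp add: mix_density_def Theta_def mixture_nonneg)

lemma borel_measurable_mix_density [measurable]: "mix_density \<theta> \<in> borel_measurable borel"
  by (simp add: mix_density_def)

lemma has_bochner_integral_mix_density:
  assumes "\<theta> \<in> Theta"
  shows "has_bochner_integral lborel (mix_density \<theta>) 1"
  using has_bochner_integral_mixture[of UNIV "($) \<theta>"] Theta_pos[OF assms] assms
  by (simp add: mix_density_def Theta_def is_mixture_param_def)

text \<open>
  Intervals that are closed on the left and open on the right make the densities constant on a right
  neighbourhood of every point.  This turns equality almost everywhere into equality everywhere.
\<close>
lemma unif_density_right_locally_constant: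
  "\<forall>\<^sub>F y in at_right x. unif_density a b y = unif_density a b x"
proof -
  consider "x < a - b" | "a - b \<le> x \<and> x < a + b" | "a + b \<le> x" "a - b \<le> x" by linarith
  then show ?thesis
  proof cases
    case 1
    then show ?thesis
      by (intro eventually_at_rightI[of x "a - b"]) (auto simp: unif_density_def)
  next
    case 2
    then show ?thesis
      by (intro eventually_at_rightI[of x "a + b"]) (auto simp: unif_density_def)
  next
    case 3
    then show ?thesis
      by (intro eventually_at_rightI[of x "x + 1"]) (auto simp: unif_density_def)
  qed
qed

lemma mixture_right_locally_constant:
  assumes "finite I"
  shows "\<forall>\<^sub>F y in at_right x. mixture I p y = mixture I p x"
proof -
  have "\<forall>\<^sub>F y in at_right x. \<forall>m\<in>I. 
      unif_density (fst (snd (p m))) (snd (snd (p m))) y = unif_density (fst (snd (p m))) (snd (snd (p m))) x"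
    using assms unif_density_right_locally_constant
    by (intro eventually_ball_finite) auto
  then show ?thesis
  proof eventually_elim
    case (elim y)
    then show ?case
      unfolding mixture_def by (intro sum.cong refl) (simp add: split_beta)
  qed
qed

lemma mixture_eq_if_AE_eq:
  assumes "finite I" "finite J" and ae: "AE x in lborel. mixture I p x = mixture J q x"
  shows "mixture I p = mixture J q"
proof
  fix x
  have "\<forall>\<^sub>F y in at_right x. mixture I p y = mixture I p x \<and> mixture J q y = mixture J q x"
    using assms by (intro eventually_conj mixture_right_locally_constant)
  then obtain z where z: "x < z"
    "\<And>y. x < y \<Longrightarrow> y < z \<Longrightarrow> mixture I p y = mixture I p x \<and> mixture J q y = mixture J q x"
    by (auto simp: eventually_at_right_field)
  show "mixture I p x = mixture J q x"
  proof (rule ccontr)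
    assume ne: "mixture I p x \<noteq> mixture J q x"
    have "AE y in lborel. y \<notin> {x<..<z}"
      using ae
    proof eventually_elim
      case (elim y)
      then show ?case using z(2)[of y] ne by auto
    qed
    then have "emeasure lborel {x<..<z} = 0"
      by (subst (asm) AE_iff_measurable[of "{x<..<z}"]) auto
    with z show False by simp
  qed
qed

lemma mixture_reindex:
  assumes "bij_betw h J I"
  shows "mixture J (p \<circ> h) = mixture I p" "is_mixture_param J (p \<circ> h) \<longleftrightarrow> is_mixture_param I p"
proof -
  show "mixture J (p \<circ> h) = mixture I p"
    unfolding mixture_def
    using sum.reindex_bij_betw[OF assms, of "\<lambda>m. case p m of (\<alpha>, a, b) \<Rightarrow> \<alpha> * unif_density a b x" for x]
    by (auto simp: o_def)
  have "h ` J = I" using assms by (simp add: bij_betw_def)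
  then have "(\<forall>m\<in>J. P (p (h m))) \<longleftrightarrow> (\<forall>m\<in>I. P (p m))" for P :: "real \<times> real \<times> real \<Rightarrow> bool"
    by auto
  then show "is_mixture_param J (p \<circ> h) \<longleftrightarrow> is_mixture_param I p"
    unfolding is_mixture_param_def
    using sum.reindex_bij_betw[OF assms, of "\<lambda>m. case p m of (\<alpha>, a, b) \<Rightarrow> \<alpha>"]
    by (simp only: o_def)
qed

section \<open>The Hellinger affinity\<close>

text \<open>
  The Bhattacharyya coefficient, or Hellinger affinity, of two densities.
\<close>
definition affinity :: "(real \<Rightarrow> real) \<Rightarrow> (real \<Rightarrow> real) \<Rightarrow> real" where
  "affinity f g = (\<integral>x. sqrt (f x * g x) \<partial>lborel)"

lemma integrable_sqrt_mult:
  fixes f g :: "real \<Rightarrow> real"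
  assumes f: "integrable lborel f" and g: "integrable lborel g"
    and nn: "\<And>x. 0 \<le> f x" "\<And>x. 0 \<le> g x"
  shows "integrable lborel (\<lambda>x. sqrt (f x * g x))"
proof (rule Bochner_Integration.integrable_bound)
  show "integrable lborel (\<lambda>x. (f x + g x) / 2)"
    using f g by simp
  show "(\<lambda>x. sqrt (f x * g x)) \<in> borel_measurable lborel"
    using f g by (auto dest: borel_measurable_integrable)
  show "AE x in lborel. norm (sqrt (f x * g x)) \<le> norm ((f x + g x) / 2)"
  proof (intro AE_I2)
    fix x
    show "norm (sqrt (f x * g x)) \<le> norm ((f x + g x) / 2)"
      using arith_geo_mean_sqrt[OF nn(1)[of x] nn(2)[of x]] nn[of x] by simp
  qed
qed

lemma nn_integral_Hellinger:
  fixes f g :: "real \<Rightarrow> real"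
  assumes f: "has_bochner_integral lborel f 1" and g: "has_bochner_integral lborel g 1"
    and nn: "\<And>x. 0 \<le> f x" "\<And>x. 0 \<le> g x"
  shows "(\<integral>\<^sup>+x. ennreal ((sqrt (f x) - sqrt (g x))\<^sup>2) \<partial>lborel) = ennreal (2 - 2 * affinity f g)"
proof -
  have int: "integrable lborel f" "integrable lborel g" "integrable lborel (\<lambda>x. sqrt (f x * g x))"
    using f g nn by (auto simp: has_bochner_integral_iff intro: integrable_sqrt_mult)
  have eq: "(sqrt (f x) - sqrt (g x))\<^sup>2 = f x + g x - 2 * sqrt (f x * g x)" for x
    using nn[of x] by (simp add: power2_diff real_sqrt_mult)
  show ?thesis
    unfolding eq
  proof (subst nn_integral_eq_integral)
    show "integrable lborel (\<lambda>x. f x + g x - 2 * sqrt (f x * g x))"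
      using int by simp
    show "AE x in lborel. 0 \<le> f x + g x - 2 * sqrt (f x * g x)"
      using arith_geo_mean_sqrt nn by (intro AE_I2) (simp add: field_simps)
    show "ennreal (\<integral>x. f x + g x - 2 * sqrt (f x * g x) \<partial>lborel) = ennreal (2 - 2 * affinity f g)"
      using int f g by (simp add: affinity_def has_bochner_integral_iff)
  qed
qed

text \<open>
  By Fatou's lemma, the squared Hellinger distance of the almost everywhere limit from \<open>g\<close> is at most
  the limit of the squared Hellinger distances, which is \<open>0\<close>.  The limit \<open>h\<close> may have lost mass a
  priori; the conclusion excludes this.
\<close>
lemma AE_eq_if_affinity_tendsto_1:
  fixes f :: "nat \<Rightarrow> real \<Rightarrow> real"
  assumes f: "\<And>k. has_bochner_integral lborel (f k) 1" "\<And>k x. 0 \<le> f k x"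
    and g: "has_bochner_integral lborel g 1" "\<And>x. 0 \<le> g x"
    and h: "\<And>x. 0 \<le> h x" "h \<in> borel_measurable borel"
    and lim: "AE x in lborel. (\<lambda>k. f k x) \<longlonglongrightarrow> h x"
    and aff: "(\<lambda>k. affinity (f k) g) \<longlonglongrightarrow> 1"
  shows "AE x in lborel. h x = g x"
proof -
  have [measurable]: "f k \<in> borel_measurable borel" "g \<in> borel_measurable borel" for k
    using f(1)[of k] g(1) by (auto simp: has_bochner_integral_iff)
  note h(2)[measurable]
  have "(\<integral>\<^sup>+x. ennreal ((sqrt (h x) - sqrt (g x))\<^sup>2) \<partial>lborel) =
      (\<integral>\<^sup>+x. liminf (\<lambda>k. ennreal ((sqrt (f k x) - sqrt (g x))\<^sup>2)) \<partial>lborel)"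
  proof (intro nn_integral_cong_AE)
    show "AE x in lborel. ennreal ((sqrt (h x) - sqrt (g x))\<^sup>2) =
        liminf (\<lambda>k. ennreal ((sqrt (f k x) - sqrt (g x))\<^sup>2))"
      using lim
    proof eventually_elim
      case (elim x)
      then have "(\<lambda>k. ennreal ((sqrt (f k x) - sqrt (g x))\<^sup>2)) \<longlonglongrightarrow>
          ennreal ((sqrt (h x) - sqrt (g x))\<^sup>2)"
        by (intro tendsto_ennrealI tendsto_power tendsto_diff tendsto_real_sqrt tendsto_const)
      then show ?case
        using lim_imp_Liminf[OF sequentially_bot] by metis
    qed
  qed
  also have "\<dots> \<le> liminf (\<lambda>k. \<integral>\<^sup>+x. ennreal ((sqrt (f k x) - sqrt (g x))\<^sup>2) \<partial>lborel)"
    by (intro nn_integral_liminf) simp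
  also have "\<dots> = liminf (\<lambda>k. ennreal (2 - 2 * affinity (f k) g))"
    by (simp add: nn_integral_Hellinger f g)
  also have "\<dots> = 0"
  proof -
    have "(\<lambda>k. ennreal (2 - 2 * affinity (f k) g)) \<longlonglongrightarrow> ennreal (2 - 2 * 1)"
      using aff by (intro tendsto_ennrealI tendsto_intros)
    then show ?thesis
      using lim_imp_Liminf[OF sequentially_bot] by fastforce
  qed
  finally have "(\<integral>\<^sup>+x. ennreal ((sqrt (h x) - sqrt (g x))\<^sup>2) \<partial>lborel) = 0"
    by simp
  then have "AE x in lborel. ennreal ((sqrt (h x) - sqrt (g x))\<^sup>2) = 0"
    by (subst (asm) nn_integral_0_iff_AE) auto
  then show ?thesis
  proof eventually_elim
    case (elim x)
    then have "(sqrt (h x) - sqrt (g x))\<^sup>2 = 0" by (simp add: ennreal_eq_0_iff)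
    then show ?case by simp
  qed
qed

section \<open>Convergent and degenerating components\<close>

text \<open>
  The density is not continuous in the parameters at an endpoint of the limit interval, whence the
  two excluded points.
\<close>
lemma unif_density_tendsto:
  assumes a: "(a \<longlongrightarrow> a') F" and b: "(b \<longlongrightarrow> b') F" and "0 < b'"
    and x: "x \<noteq> a' - b'" "x \<noteq> a' + b'"
  shows "((\<lambda>k. unif_density (a k) (b k) x) \<longlongrightarrow> unif_density a' b' x) F"
proof -
  have l: "((\<lambda>k. a k - b k) \<longlongrightarrow> a' - b') F" and u: "((\<lambda>k. a k + b k) \<longlongrightarrow> a' + b') F"
    using tendsto_diff[OF a b] tendsto_add[OF a b] by simp_all
  consider "x < a' - b'" | "a' - b' < x" "x < a' + b'" | "a' + b' < x"
    using x by linarith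
  then show ?thesis
  proof cases
    case 1
    from order_tendstoD(1)[OF l 1] have "\<forall>\<^sub>F k in F. unif_density (a k) (b k) x = unif_density a' b' x"
      by eventually_elim (use 1 in \<open>simp add: unif_density_def\<close>)
    then show ?thesis by (rule tendsto_eventually)
  next
    case 2
    have "\<forall>\<^sub>F k in F. unif_density (a k) (b k) x = 1 / (2 * b k)"
      using order_tendstoD(2)[OF l 2(1)] order_tendstoD(1)[OF u 2(2)]
      by eventually_elim (simp add: unif_density_def)
    moreover have "((\<lambda>k. 1 / (2 * b k)) \<longlongrightarrow> 1 / (2 * b')) F"
      using b \<open>0 < b'\<close> by (auto intro!: tendsto_intros)
    moreover have "unif_density a' b' x = 1 / (2 * b')"
      using 2 by (simp add: unif_density_def)
    ultimately show ?thesis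
      using tendsto_cong by (simp add: tendsto_cong)
  next
    case 3
    from order_tendstoD(2)[OF u 3] have "\<forall>\<^sub>F k in F. unif_density (a k) (b k) x = unif_density a' b' x"
      by eventually_elim (use 3 in \<open>simp add: unif_density_def\<close>)
    then show ?thesis by (rule tendsto_eventually)
  qed
qed

lemma tendsto_tan_of_arctan:
  fixes a :: "'k \<Rightarrow> real"
  assumes "((\<lambda>k. arctan (a k)) \<longlongrightarrow> A) F" "- (pi / 2) < A" "A < pi / 2"
  shows "(a \<longlongrightarrow> tan A) F"
proof -
  have "cos A \<noteq> 0" using cos_gt_zero_pi[of A] assms(2,3) by simp
  then have "((\<lambda>k. tan (arctan (a k))) \<longlongrightarrow> tan A) F"
    using isCont_tendsto_compose[OF isCont_tan assms(1)] by simp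
  then show ?thesis by (simp add: tan_arctan)
qed

text \<open>
  The half-plane of centres and half-widths is compactified by applying \<open>arctan\<close> to both.  If
  the limit is not in the interior, then the component degenerates: it becomes infinitely wide, or
  it moves out of sight with bounded width, or it is concentrated at the single point \<open>tan A\<close>.
  For \<open>A = \<plusminus> pi / 2\<close> the excluded point \<open>tan A\<close> has no meaning but does no harm, since a finite set
  of exceptions is negligible.
\<close>
lemma unif_density_vanishes:
  assumes A: "((\<lambda>k. arctan (a k)) \<longlongrightarrow> A) F" and B: "((\<lambda>k. arctan (b k)) \<longlongrightarrow> B) F"
    and A_bds: "- (pi / 2) \<le> A" "A \<le> pi / 2" and B_bds: "0 \<le> B" "B \<le> pi / 2"
    and pos: "\<And>k. 0 < b k"
    and deg: "\<not> (- (pi / 2) < A \<and> A < pi / 2 \<and> 0 < B \<and> B < pi / 2)"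
    and x: "x \<noteq> tan A"
  shows "((\<lambda>k. unif_density (a k) (b k) x) \<longlongrightarrow> 0) F"
proof -
  consider "B = pi / 2" | "B < pi / 2" "A = pi / 2 \<or> A = - (pi / 2)"
    | "B = 0" "- (pi / 2) < A" "A < pi / 2"
    using deg A_bds B_bds by linarith
  then show ?thesis
  \<comment> \<open>The cases are: infinitely wide; bounded width but escaping to infinity; concentrated at a
    point.\<close>
  proof cases
    case 1
    show ?thesis
    proof (rule order_tendstoI)
      fix e :: real assume "e < 0"
      then have "e < unif_density (a k) (b k) x" for k
        using unif_density_nonneg[OF pos[of k]] by (rule less_le_trans)
      then show "\<forall>\<^sub>F k in F. e < unif_density (a k) (b k) x"
        by simp
    next
      fix e :: real assume e: "0 < e"
      have "arctan (1 / e) < B"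
        unfolding 1 by (rule arctan_ubound)
      with B have "\<forall>\<^sub>F k in F. arctan (1 / e) < arctan (b k)"
        by (rule order_tendstoD(1))
      then show "\<forall>\<^sub>F k in F. unif_density (a k) (b k) x < e"
      proof eventually_elim
        case (elim k)
        then have "1 / e < b k" by (simp add: arctan_less_iff)
        then have "1 / (2 * b k) < e" using e pos[of k] by (simp add: field_simps)
        then show ?case using unif_density_le[OF pos[of k], of "a k" x] by linarith
      qed
    qed
  next
    case 2
    then obtain B' where B': "B < B'" "B' < pi / 2" using dense by blast
    define K where "K = tan B'"
    have K: "arctan K = B'" unfolding K_def using B' B_bds pi_gt_zero by (intro arctan_tan) linarith+
    have bK: "\<forall>\<^sub>F k in F. b k < K"
      using order_tendstoD(2)[OF B B'(1)] by (simp add: arctan_less_iff flip: K)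
    have "\<forall>\<^sub>F k in F. x + K < a k \<or> a k < x - K"
      using 2(2)
    proof
      assume "A = pi / 2"
      then have "arctan (x + K) < A" by (simp only: arctan_ubound)
      from order_tendstoD(1)[OF A this] show ?thesis
        by eventually_elim (simp add: arctan_less_iff)
    next
      assume "A = - (pi / 2)"
      then have "A < arctan (x - K)" using arctan_lbound by simp
      from order_tendstoD(2)[OF A this] show ?thesis
        by eventually_elim (simp add: arctan_less_iff)
    qed
    with bK have "\<forall>\<^sub>F k in F. unif_density (a k) (b k) x = 0"
      by eventually_elim (auto simp: unif_density_def)
    then show ?thesis by (rule tendsto_eventually)
  next
    case 3
    have a: "(a \<longlongrightarrow> tan A) F" using tendsto_tan_of_arctan[OF A] 3 by simp
    have b: "(b \<longlongrightarrow> 0) F" using tendsto_tan_of_arctan[OF B] 3 by simp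
    have "((\<lambda>k. \<bar>x - a k\<bar> - b k) \<longlongrightarrow> \<bar>x - tan A\<bar> - 0) F"
      using a b by (intro tendsto_intros)
    then have "\<forall>\<^sub>F k in F. 0 < \<bar>x - a k\<bar> - b k"
      using x by (intro order_tendstoD(1)) auto
    then have "\<forall>\<^sub>F k in F. unif_density (a k) (b k) x = 0"
      by eventually_elim (auto simp: unif_density_def)
    then show ?thesis by (rule tendsto_eventually)
  qed
qed

text \<open>
  \<open>S\<close> is the set of components that do not degenerate along the subsequence, and \<open>N\<close> collects the
  finitely many points at which the densities of single components need not converge.
\<close>
lemma Theta_subsequence:
  fixes \<theta> :: "nat \<Rightarrow> 'm::finite params"
  assumes \<theta>: "\<And>k. \<theta> k \<in> Theta"
  obtains r S p N where "strict_mono (r :: nat \<Rightarrow> nat)"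
    "\<And>m. m \<in> S \<Longrightarrow> (\<lambda>k. \<theta> (r k) $ m) \<longlonglongrightarrow> p m"
    "\<And>m. m \<in> S \<Longrightarrow> 0 < snd (snd (p m))"
    "finite N" "\<And>x. x \<notin> N \<Longrightarrow> (\<lambda>k. mix_density (\<theta> (r k)) x) \<longlonglongrightarrow> mixture S p x"
proof -
  define \<alpha> a b where "\<alpha> k m = fst (\<theta> k $ m)" and "a k m = fst (snd (\<theta> k $ m))"
    and "b k m = snd (snd (\<theta> k $ m))" for k m
  have \<theta>_eq: "\<theta> k $ m = (\<alpha> k m, a k m, b k m)" for k m
    by (simp add: \<alpha>_def a_def b_def)
  have \<alpha>_bds: "0 \<le> \<alpha> k m" "\<alpha> k m \<le> 1" and b_pos: "0 < b k m" for k m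
    using Theta_D[OF \<theta> \<theta>_eq] by blast+
  define \<phi> :: "nat \<Rightarrow> 'm params" where "\<phi> k = (\<chi> m. (\<alpha> k m, arctan (a k m), arctan (b k m)))" for k
  have "bounded (range \<phi>)"
    unfolding bounded_iff
  proof (intro exI ballI)
    fix v assume "v \<in> range \<phi>"
    then obtain k where v: "v = \<phi> k" by blast
    have "norm (\<phi> k) \<le> (\<Sum>m\<in>UNIV. norm (\<phi> k $ m))"
      unfolding norm_vec_def by (rule L2_set_le_sum) simp
    also have "\<dots> \<le> (\<Sum>m\<in>(UNIV :: 'm set). 1 + (pi / 2 + pi / 2))"
    proof (rule sum_mono)
      fix m
      have "norm (\<phi> k $ m) \<le> norm (\<alpha> k m) + (norm (arctan (a k m)) + norm (arctan (b k m)))"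
        using norm_Pair_le[of "\<alpha> k m" "(arctan (a k m), arctan (b k m))"]
          norm_Pair_le[of "arctan (a k m)" "arctan (b k m)"] by (simp add: \<phi>_def)
      also have "\<dots> \<le> 1 + (pi / 2 + pi / 2)"
        using \<alpha>_bds[of k m] arctan_bounded[of "a k m"] arctan_bounded[of "b k m"]
        by (intro add_mono) (auto simp: abs_le_iff)
      finally show "norm (\<phi> k $ m) \<le> 1 + (pi / 2 + pi / 2)" .
    qed
    finally show "norm v \<le> (\<Sum>m\<in>(UNIV :: 'm set). 1 + (pi / 2 + pi / 2))"
      by (simp only: v)
  qed
  then obtain l r where r: "strict_mono r" and l: "(\<phi> \<circ> r) \<longlonglongrightarrow> l"
    using bounded_imp_convergent_subsequence by blast
  define \<alpha>' A B where "\<alpha>' m = fst (l $ m)" and "A m = fst (snd (l $ m))"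
    and "B m = snd (snd (l $ m))" for m
  have l_m: "(\<lambda>k. \<phi> (r k) $ m) \<longlonglongrightarrow> l $ m" for m
    using tendsto_vec_nth[OF l] by (simp add: o_def)
  have lim_\<alpha>: "(\<lambda>k. \<alpha> (r k) m) \<longlonglongrightarrow> \<alpha>' m"
    and lim_A: "(\<lambda>k. arctan (a (r k) m)) \<longlonglongrightarrow> A m"
    and lim_B: "(\<lambda>k. arctan (b (r k) m)) \<longlonglongrightarrow> B m" for m
    using tendsto_fst[OF l_m[of m]] tendsto_fst[OF tendsto_snd[OF l_m[of m]]]
      tendsto_snd[OF tendsto_snd[OF l_m[of m]]]
    by (simp_all add: \<phi>_def \<alpha>'_def A_def B_def)
  have A_bds: "- (pi / 2) \<le> A m" "A m \<le> pi / 2" for m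
    using arctan_lbound arctan_ubound
    by (intro LIMSEQ_le_const[OF lim_A] LIMSEQ_le_const2[OF lim_A] exI allI impI less_imp_le; fast)+
  have B_bds: "0 \<le> B m" "B m \<le> pi / 2" for m
    using arctan_ubound b_pos
    by (intro LIMSEQ_le_const[OF lim_B] LIMSEQ_le_const2[OF lim_B] exI allI impI less_imp_le; simp)+
  define S where "S = {m. - (pi / 2) < A m \<and> A m < pi / 2 \<and> 0 < B m \<and> B m < pi / 2}"
  define p where "p m = (\<alpha>' m, tan (A m), tan (B m))" for m
  define N where "N = (\<Union>m. {tan (A m), tan (A m) - tan (B m), tan (A m) + tan (B m)})"
  have lim_a: "(\<lambda>k. a (r k) m) \<longlonglongrightarrow> tan (A m)" and lim_b: "(\<lambda>k. b (r k) m) \<longlonglongrightarrow> tan (B m)"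
    and tan_B: "0 < tan (B m)" if "m \<in> S" for m
    using that tendsto_tan_of_arctan[OF lim_A] tendsto_tan_of_arctan[OF lim_B] tan_gt_zero
    by (auto simp: S_def)
  show ?thesis
  proof (rule that[OF r])
    show "(\<lambda>k. \<theta> (r k) $ m) \<longlonglongrightarrow> p m" if "m \<in> S" for m
      using lim_\<alpha> lim_a[OF that] lim_b[OF that] by (auto simp: \<theta>_eq p_def intro!: tendsto_Pair)
    show "0 < snd (snd (p m))" if "m \<in> S" for m
      using tan_B[OF that] by (simp add: p_def)
    show "finite N" by (simp add: N_def)
    show "(\<lambda>k. mix_density (\<theta> (r k)) x) \<longlonglongrightarrow> mixture S p x" if "x \<notin> N" for x
    proof -
      have x: "x \<noteq> tan (A m)" "x \<noteq> tan (A m) - tan (B m)" "x \<noteq> tan (A m) + tan (B m)" for m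
        using that by (auto simp: N_def)
      have "(\<lambda>k. \<alpha> (r k) m * unif_density (a (r k) m) (b (r k) m) x) \<longlonglongrightarrow>
          (if m \<in> S then \<alpha>' m * unif_density (tan (A m)) (tan (B m)) x else 0)" for m
      proof (cases "m \<in> S")
        case True
        then show ?thesis
          using tendsto_mult[OF lim_\<alpha> unif_density_tendsto[OF lim_a lim_b tan_B x(2,3)]] by simp
      next
        case False
        then have "(\<lambda>k. unif_density (a (r k) m) (b (r k) m) x) \<longlonglongrightarrow> 0"
          using b_pos x(1)
          by (intro unif_density_vanishes[OF lim_A lim_B A_bds B_bds]) (auto simp: S_def)
        from tendsto_mult[OF lim_\<alpha> this] False show ?thesis by simp
      qed
      then have "(\<lambda>k. \<Sum>m\<in>UNIV. \<alpha> (r k) m * unif_density (a (r k) m) (b (r k) m) x) \<longlonglongrightarrow>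
          (\<Sum>m\<in>UNIV. if m \<in> S then \<alpha>' m * unif_density (tan (A m)) (tan (B m)) x else 0)"
        by (intro tendsto_sum)
      also have "(\<Sum>m\<in>UNIV. if m \<in> S then \<alpha>' m * unif_density (tan (A m)) (tan (B m)) x else 0) =
          mixture S p x"
        by (simp add: mixture_def p_def sum.If_cases)
      finally show ?thesis
        by (simp add: mix_density_def mixture_def \<theta>_eq)
    qed
  qed
qed

text \<open>
  The mixture of the limits of the non-degenerating components equals the true density.  Therefore
  its weights have sum \<open>1\<close>, and by minimality it has all the components.
\<close>
lemma subsequence_tendsto_true_params:
  fixes \<theta> :: "nat \<Rightarrow> 'm::finite params" and \<theta>\<^sub>0 :: "'m params"
  assumes \<theta>: "\<And>k. \<theta> k \<in> Theta" and \<theta>\<^sub>0: "\<theta>\<^sub>0 \<in> Theta"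
    and minimal: "\<And>M' p. M' < CARD('m) \<Longrightarrow> is_mixture_param {..<M'::nat} p \<Longrightarrow>
           mix_density \<theta>\<^sub>0 \<noteq> mixture {..<M'} p"
    and aff: "(\<lambda>k. affinity (mix_density (\<theta> k)) (mix_density \<theta>\<^sub>0)) \<longlonglongrightarrow> 1"
  obtains r \<theta>' where "strict_mono r" "\<theta>' \<in> true_params \<theta>\<^sub>0" "(\<theta> \<circ> r) \<longlonglongrightarrow> \<theta>'"
proof -
  obtain r S p N where r: "strict_mono (r :: nat \<Rightarrow> nat)"
    and lim: "\<And>m. m \<in> S \<Longrightarrow> (\<lambda>k. \<theta> (r k) $ m) \<longlonglongrightarrow> p m"
    and b_pos: "\<And>m. m \<in> S \<Longrightarrow> 0 < snd (snd (p m))"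
    and N: "finite N" and lim_f: "\<And>x. x \<notin> N \<Longrightarrow> (\<lambda>k. mix_density (\<theta> (r k)) x) \<longlonglongrightarrow> mixture S p x"
    by (rule Theta_subsequence[of \<theta>, OF \<theta>]) (rule that)
  have \<alpha>_nonneg: "0 \<le> fst (p m)" and \<alpha>_le: "fst (p m) \<le> 1" if "m \<in> S" for m
  proof -
    have "0 \<le> fst (\<theta> k $ m)" "fst (\<theta> k $ m) \<le> 1" for k
      using Theta_D[OF \<theta>] by (metis prod.collapse)+
    then show "0 \<le> fst (p m)" "fst (p m) \<le> 1"
      using tendsto_fst[OF lim[OF that]]
      by (auto intro: LIMSEQ_le_const LIMSEQ_le_const2)
  qed
  have "AE x in lborel. mixture S p x = mix_density \<theta>\<^sub>0 x"
  proof (rule AE_eq_if_affinity_tendsto_1[where f = "\<lambda>k. mix_density (\<theta> (r k))"])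
    show "0 \<le> mixture S p x" for x
      unfolding mixture_def using \<alpha>_nonneg b_pos
      by (intro sum_nonneg) (auto simp: split_beta intro!: mult_nonneg_nonneg unif_density_nonneg)
    show "AE x in lborel. (\<lambda>k. mix_density (\<theta> (r k)) x) \<longlonglongrightarrow> mixture S p x"
    proof (rule AE_mp[OF AE_not_in[of N] AE_I2])
      show "N \<in> null_sets lborel" using N by (rule finite_imp_null_set_lborel)
    qed (use lim_f in auto)
    show "(\<lambda>k. affinity (mix_density (\<theta> (r k))) (mix_density \<theta>\<^sub>0)) \<longlonglongrightarrow> 1"
      using LIMSEQ_subseq_LIMSEQ[OF aff r] by (simp add: o_def)
  qed (auto simp: has_bochner_integral_mix_density mix_density_nonneg \<theta> \<theta>\<^sub>0)
  then have f_eq: "mixture S p = mix_density \<theta>\<^sub>0"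
    unfolding mix_density_def by (intro mixture_eq_if_AE_eq) auto
  have "(\<Sum>m\<in>S. case p m of (\<alpha>, a, b) \<Rightarrow> \<alpha>) = 1"
    using has_bochner_integral_mixture[of S p] b_pos has_bochner_integral_mix_density[OF \<theta>\<^sub>0] f_eq
    by (metis has_bochner_integral_eq)
  then have param: "is_mixture_param S p"
    using \<alpha>_nonneg \<alpha>_le b_pos by (auto simp: is_mixture_param_def split_beta)
  have "S = UNIV"
  proof (rule ccontr)
    assume "S \<noteq> UNIV"
    then have "card S < CARD('m)" by (intro psubset_card_mono) auto
    obtain h where h: "bij_betw h {..<card S} S"
      using ex_bij_betw_nat_finite[of S] by (auto simp: lessThan_atLeast0)
    show False
      using minimal[OF \<open>card S < CARD('m)\<close>, of "p \<circ> h"] mixture_reindex[OF h, of p] param f_eq by simp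
  qed
  show ?thesis
  proof (rule that[OF r])
    show "(\<theta> \<circ> r) \<longlonglongrightarrow> (\<chi> m. p m)"
      using lim \<open>S = UNIV\<close> by (intro vec_tendstoI) (simp add: o_def)
    show "(\<chi> m. p m) \<in> true_params \<theta>\<^sub>0"
      using param f_eq \<open>S = UNIV\<close> vec_lambda_inverse[of p]
      by (simp add: true_params_def Theta_def mix_density_def)
  qed
qed

section \<open>Separation of distant parameters\<close>

text \<open>
  This quantitative form of identifiability is uniform over the whole parameter space, however
  narrow, wide or distant the components may be.
\<close>
lemma affinity_separation:
  fixes \<theta>\<^sub>0 :: "'m::finite params"
  assumes \<theta>\<^sub>0: "\<theta>\<^sub>0 \<in> Theta"
    and minimal: "\<And>M' p. M' < CARD('m) \<Longrightarrow> is_mixture_param {..<M'::nat} p \<Longrightarrow>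
           mix_density \<theta>\<^sub>0 \<noteq> mixture {..<M'} p"
    and "0 < \<epsilon>"
  obtains \<eta> where "0 < \<eta>" "\<eta> \<le> 1"
    "\<And>\<theta>. \<theta> \<in> Theta \<Longrightarrow> \<epsilon> \<le> infdist \<theta> (true_params \<theta>\<^sub>0) \<Longrightarrow>
      affinity (mix_density \<theta>) (mix_density \<theta>\<^sub>0) \<le> 1 - \<eta>"
proof -
  have "\<exists>\<eta>. 0 < \<eta> \<and> \<eta> \<le> 1 \<and> (\<forall>\<theta>\<in>Theta. \<epsilon> \<le> infdist \<theta> (true_params \<theta>\<^sub>0) \<longrightarrow>
      affinity (mix_density \<theta>) (mix_density \<theta>\<^sub>0) \<le> 1 - \<eta>)"
  proof (rule ccontr)
    assume contra: "\<not> ?thesis"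
    have "\<exists>\<theta>\<in>Theta. \<epsilon> \<le> infdist \<theta> (true_params \<theta>\<^sub>0) \<and>
        1 - 1 / real (Suc k) < affinity (mix_density \<theta>) (mix_density \<theta>\<^sub>0)" for k
      using contra[simplified, rule_format, of "1 / real (Suc k)"] by (auto simp: not_le)
    then obtain \<theta> where \<theta>: "\<And>k. \<theta> k \<in> Theta" "\<And>k. \<epsilon> \<le> infdist (\<theta> k) (true_params \<theta>\<^sub>0)"
      "\<And>k. 1 - 1 / real (Suc k) < affinity (mix_density (\<theta> k)) (mix_density \<theta>\<^sub>0)"
      by metis
    have le_1: "affinity (mix_density (\<theta> k)) (mix_density \<theta>\<^sub>0) \<le> 1" for k
    proof -
      have "affinity (mix_density (\<theta> k)) (mix_density \<theta>\<^sub>0) \<le>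
          (\<integral>x. (mix_density (\<theta> k) x + mix_density \<theta>\<^sub>0 x) / 2 \<partial>lborel)"
        unfolding affinity_def
        using has_bochner_integral_mix_density[OF \<theta>(1)[of k]] has_bochner_integral_mix_density[OF \<theta>\<^sub>0]
          mix_density_nonneg[OF \<theta>(1)[of k]] mix_density_nonneg[OF \<theta>\<^sub>0]
        by (intro integral_mono integrable_sqrt_mult arith_geo_mean_sqrt) (auto simp: has_bochner_integral_iff)
      also have "\<dots> = 1"
        using has_bochner_integral_mix_density[OF \<theta>(1)[of k]] has_bochner_integral_mix_density[OF \<theta>\<^sub>0]
        by (simp add: has_bochner_integral_iff)
      finally show ?thesis .
    qed
    have "(\<lambda>k. affinity (mix_density (\<theta> k)) (mix_density \<theta>\<^sub>0)) \<longlonglongrightarrow> 1"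
    proof (rule tendsto_sandwich)
      show "(\<lambda>k. 1 - 1 / real (Suc k)) \<longlonglongrightarrow> 1"
        using tendsto_diff[OF tendsto_const LIMSEQ_inverse_real_of_nat, of 1] by (simp add: divide_inverse)
      show "(\<lambda>k. 1 :: real) \<longlonglongrightarrow> 1" by simp
    qed (use \<theta>(3) le_1 in \<open>auto intro!: always_eventually less_imp_le\<close>)
    then obtain r \<theta>' where r: "strict_mono r" "\<theta>' \<in> true_params \<theta>\<^sub>0" "(\<theta> \<circ> r) \<longlonglongrightarrow> \<theta>'"
      using subsequence_tendsto_true_params[of \<theta>, OF \<theta>(1) \<theta>\<^sub>0 minimal] by metis
    from tendsto_dist[OF r(3) tendsto_const[of \<theta>']] have "(\<lambda>k. dist (\<theta> (r k)) \<theta>') \<longlonglongrightarrow> 0"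
      by simp
    then have "\<epsilon> \<le> 0"
    proof (rule LIMSEQ_le_const)
      show "\<exists>K. \<forall>k\<ge>K. \<epsilon> \<le> dist (\<theta> (r k)) \<theta>'"
        using \<theta>(2) infdist_le[OF r(2)] order_trans by blast
    qed
    with \<open>0 < \<epsilon>\<close> show False by simp
  qed
  then show ?thesis using that by blast
qed

section \<open>Upper brackets\<close>

text \<open>
  Only the upper half of a bracket is needed to bound a likelihood, and only on a set \<open>A\<close> that contains
  the observations.  Accordingly the excess of the bracket is measured against the mass of \<open>f\<close> on \<open>A\<close>.
\<close>
definition upper_brackets :: "real set \<Rightarrow> real \<Rightarrow> (real \<Rightarrow> real) set \<Rightarrow> (real \<Rightarrow> real) set \<Rightarrow> bool" where
  "upper_brackets A \<epsilon> F G \<longleftrightarrow>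
     finite G \<and> (\<forall>g\<in>G. integrable lborel g \<and> (\<forall>x. 0 \<le> g x)) \<and>
     (\<forall>f\<in>F. \<exists>g\<in>G. (\<forall>x\<in>A. f x \<le> g x) \<and>
       (\<integral>x. g x \<partial>lborel) \<le> (\<integral>x. indicator A x * f x \<partial>lborel) + \<epsilon>)"

lemma upper_brackets_mono: "F \<subseteq> F' \<Longrightarrow> upper_brackets A \<epsilon> F' G \<Longrightarrow> upper_brackets A \<epsilon> F G"
  unfolding upper_brackets_def by blast

definition scaled_unif_densities :: "real \<Rightarrow> (real \<Rightarrow> real) set" where
  "scaled_unif_densities c = {\<lambda>x. \<alpha> * unif_density a b x | \<alpha> a b. 0 \<le> \<alpha> \<and> \<alpha> \<le> 1 \<and> c \<le> b}"

text \<open>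
  A scaled uniform density restricted to \<open>[-R, R)\<close> is a box, given by its height and its two
  endpoints.  The height, at most \<open>1 / (2 c)\<close>, is rounded up to a multiple of \<open>\<delta>\<close>, and the endpoints
  are rounded outwards to multiples of \<open>h\<close>.  Moving the endpoints costs at most \<open>2 h / (2 c)\<close>, so that
  \<open>h\<close> has to be proportional to \<open>c\<close>, whereas \<open>\<delta>\<close> does not depend on \<open>c\<close>.  Each of the three
  discretised numbers then has \<open>O (1 / c)\<close> possible values.
\<close>
lemma component_brackets:
  fixes R \<epsilon> c :: real
  assumes R: "0 < R" and \<epsilon>: "0 < \<epsilon>" and c: "0 < c" "c \<le> 1"
  shows "\<exists>G. upper_brackets {-R..<R} \<epsilon> (scaled_unif_densities c) G \<and>
    real (card G) \<le> (4 * R / \<epsilon> + 3)\<^sup>2 * ((2 * R + \<epsilon>) / \<epsilon> + 2) / c ^ 3"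
proof -
  \<comment> \<open>The grids are chosen so that the endpoints and the height each contribute at most half of the
    excess, see the estimate of the integral below.\<close>
  define h where "h = c * \<epsilon> / 2"
  define \<delta> where "\<delta> = \<epsilon> / 2 / (2 * R + \<epsilon>)"
  define K where "K = \<lceil>R / h\<rceil>"
  define L where "L = \<lceil>1 / (2 * c) / \<delta>\<rceil>"
  have h: "0 < h" "h \<le> \<epsilon> / 2" using c \<epsilon> by (auto simp: h_def mult_left_le_one_le)
  have \<delta>: "0 < \<delta>" using \<epsilon> R by (simp add: \<delta>_def)
  have K: "0 \<le> K" and L: "0 \<le> L"
    using R h c \<delta> ceiling_mono[of 0 "R / h"] ceiling_mono[of 0 "1 / (2 * c) / \<delta>"]
    by (simp_all add: K_def L_def)
  define box :: "int \<times> int \<times> int \<Rightarrow> real \<Rightarrow> real"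
    where "box = (\<lambda>(i, j, k) x. real_of_int i * \<delta> * indicator {j * h..<k * h} x)"
  define G where "G = box ` ({0..L} \<times> {-K..K} \<times> {-K..K})"
  have box_integral: "has_bochner_integral lborel (box (i, j, k)) (i * \<delta> * max 0 (k * h - j * h))" for i j k
  proof -
    have "has_bochner_integral lborel (indicator {j * h..<k * h}) (max 0 (k * h - j * h))"
      using has_bochner_integral_real_indicator[of "{j * h..<k * h}" lborel]
      by (cases "j * h \<le> k * h") (auto simp: max_def)
    then show ?thesis
      unfolding box_def by (auto intro: has_bochner_integral_mult_right)
  qed
  have "finite G" by (simp add: G_def)
  moreover have "integrable lborel g" "0 \<le> g x" if "g \<in> G" for g x
    using that box_integral \<delta> by (auto simp: G_def box_def has_bochner_integral_iff)
  moreover have card_G: "real (card G) \<le> (4 * R / \<epsilon> + 3)\<^sup>2 * ((2 * R + \<epsilon>) / \<epsilon> + 2) / c ^ 3"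
    proof -
      have "card G \<le> card ({0..L} \<times> {-K..K} \<times> {-K..K})"
        unfolding G_def by (intro card_image_le) simp
      also have "\<dots> = nat (L + 1) * (nat (2 * K + 1))\<^sup>2"
        by (simp add: card_cartesian_product power2_eq_square algebra_simps)
      finally have "real (card G) \<le> real_of_int (L + 1) * (real_of_int (2 * K + 1))\<^sup>2"
        using K L by (simp add: nat_add_distrib distrib_right add.commute flip: of_nat_le_iff[where 'a = real])
      also have "\<dots> \<le> (((2 * R + \<epsilon>) / \<epsilon> + 2) / c) * ((4 * R / \<epsilon> + 3) / c)\<^sup>2"
      proof (intro mult_mono power_mono)
        have "real_of_int L \<le> 1 / (2 * c) / \<delta> + 1" by (simp add: L_def)
        also have "1 / (2 * c) / \<delta> = (2 * R + \<epsilon>) / \<epsilon> / c"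
          using \<epsilon> R c by (simp add: \<delta>_def field_simps)
        also have "\<dots> + 1 + 1 \<le> (2 * R + \<epsilon>) / \<epsilon> / c + 2 / c"
          using c by (simp add: field_simps)
        finally show "real_of_int (L + 1) \<le> ((2 * R + \<epsilon>) / \<epsilon> + 2) / c"
          by (simp add: add_divide_distrib)
        have "real_of_int K \<le> R / h + 1" by (simp add: K_def)
        then have "real_of_int (2 * K + 1) \<le> 2 * (R / h) + 3" by simp
        also have "\<dots> \<le> 4 * R / \<epsilon> / c + 3 / c"
          using c \<epsilon> by (simp add: h_def field_simps)
        finally show "real_of_int (2 * K + 1) \<le> (4 * R / \<epsilon> + 3) / c"
          by (simp add: add_divide_distrib)
      qed (use K L R \<epsilon> c in auto)
      also have "\<dots> = (4 * R / \<epsilon> + 3)\<^sup>2 * ((2 * R + \<epsilon>) / \<epsilon> + 2) / c ^ 3"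
        by (simp add: power_divide power3_eq_cube power2_eq_square mult_ac)
      finally show ?thesis .
    qed
  moreover have "\<exists>g\<in>G. (\<forall>x\<in>{-R..<R}. \<alpha> * unif_density a b x \<le> g x) \<and>
      (\<integral>x. g x \<partial>lborel) \<le> (\<integral>x. indicator {-R..<R} x * (\<alpha> * unif_density a b x) \<partial>lborel) + \<epsilon>"
    if \<alpha>: "0 \<le> \<alpha>" "\<alpha> \<le> 1" and b: "c \<le> b" for \<alpha> a b
  proof -
    define w where "w = \<alpha> / (2 * b)"
    define l where "l = max (a - b) (- R)"
    define u where "u = min (a + b) R"
    have eq: "indicator {-R..<R} x * (\<alpha> * unif_density a b x) = w * indicator {l..<u} x" for x
      by (auto simp: unif_density_def w_def l_def u_def indicator_def)
    have w: "0 \<le> w" "w \<le> 1 / (2 * c)"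
      unfolding w_def using \<alpha> b c by (auto intro: frac_le)
    show ?thesis
    proof (cases "l < u")
      case True
      define i where "i = \<lceil>w / \<delta>\<rceil>"
      define j where "j = \<lfloor>l / h\<rfloor>"
      define k where "k = \<lceil>u / h\<rceil>"
      have lu: "- R \<le> l" "l \<le> R" "- R \<le> u" "u \<le> R"
        using True by (auto simp: l_def u_def)
      have "w / \<delta> \<le> i" "i \<le> w / \<delta> + 1" by (simp_all add: i_def)
      then have i: "w \<le> i * \<delta>" "i * \<delta> \<le> w + \<delta>"
        using \<delta> by (simp_all add: field_simps)
      have "j \<le> l / h" "l / h \<le> j + 1" by (simp_all add: j_def less_imp_le)
      then have j: "j * h \<le> l" "l \<le> j * h + h"
        using h(1) by (simp_all add: field_simps)
      have "u / h \<le> k" "k \<le> u / h + 1" by (simp_all add: k_def)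
      then have k: "u \<le> k * h" "k * h \<le> u + h"
        using h(1) by (simp_all add: field_simps)
      have "0 \<le> i" using w(1) \<delta> ceiling_mono[of 0 "w / \<delta>"] by (simp add: i_def)
      moreover have "i \<le> L" unfolding i_def L_def using w \<delta> by (intro ceiling_mono divide_right_mono) auto
      moreover have "- K \<le> j \<and> j \<le> K" "- K \<le> k \<and> k \<le> K"
      proof -
        have *: "- (R / h) \<le> l / h" "l / h \<le> R / h" "- (R / h) \<le> u / h" "u / h \<le> R / h"
          using lu h(1) by (auto simp: field_simps)
        have "- K = \<lfloor>- (R / h)\<rfloor>" by (simp add: K_def ceiling_def)
        then show "- K \<le> j \<and> j \<le> K"
          using floor_mono[OF *(1)] order_trans[OF floor_mono[OF *(2)] floor_le_ceiling]
          by (simp add: j_def K_def)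
        show "- K \<le> k \<and> k \<le> K"
          using order_trans[OF floor_le_ceiling ceiling_mono[OF *(3)]] ceiling_mono[OF *(4)]
            \<open>- K = \<lfloor>- (R / h)\<rfloor>\<close>
          by (simp add: k_def K_def)
      qed
      ultimately have "box (i, j, k) \<in> G" by (auto simp: G_def)
      moreover have "\<alpha> * unif_density a b x \<le> box (i, j, k) x" if "x \<in> {-R..<R}" for x
      proof -
        have "w * indicator {l..<u} x \<le> i * \<delta> * indicator {j * h..<k * h} x"
          using i(1) j(1) k(1) w by (auto simp: indicator_def)
        then show ?thesis using eq[of x] that by (simp add: box_def)
      qed
      moreover have "(\<integral>x. box (i, j, k) x \<partial>lborel) \<le>
          (\<integral>x. indicator {-R..<R} x * (\<alpha> * unif_density a b x) \<partial>lborel) + \<epsilon>"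
      proof -
        have "(\<integral>x. box (i, j, k) x \<partial>lborel) = i * \<delta> * (k * h - j * h)"
        proof -
          have "max 0 (k * h - j * h) = k * h - j * h" using j k True by linarith
          then show ?thesis using box_integral[of i j k] by (simp only: has_bochner_integral_iff)
        qed
        also have "\<dots> \<le> (w + \<delta>) * ((u - l) + 2 * h)"
          using i j k w \<delta> True by (intro mult_mono) auto
        also have "\<dots> = w * (u - l) + w * (2 * h) + \<delta> * ((u - l) + 2 * h)"
          by (simp add: algebra_simps)
        also have "\<dots> \<le> w * (u - l) + 1 / (2 * c) * (2 * h) + \<delta> * (2 * R + \<epsilon>)"
          using w h \<delta> lu by (intro add_mono mult_left_mono mult_right_mono) auto
        also have "\<dots> = w * (u - l) + \<epsilon>"
        proof -
          have "2 * R + \<epsilon> \<noteq> 0" using R \<epsilon> by simp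
          then have "\<delta> * (2 * R + \<epsilon>) = \<epsilon> / 2"
            by (intro iffD1[OF nonzero_eq_divide_eq]) (simp_all add: \<delta>_def)
          moreover have "1 / (2 * c) * (2 * h) = \<epsilon> / 2" using c by (simp add: h_def)
          ultimately show ?thesis by linarith
        qed
        also have "w * (u - l) = (\<integral>x. indicator {-R..<R} x * (\<alpha> * unif_density a b x) \<partial>lborel)"
          unfolding eq using True by simp
        finally show ?thesis .
      qed
      ultimately show ?thesis by blast
    next
      case False
      have zero: "box (0, 0, 0) x = 0" for x by (simp add: box_def)
      have *: "indicator {-R..<R} x * (\<alpha> * unif_density a b x) = 0" for x
        unfolding eq using False by simp
      have "\<alpha> * unif_density a b x \<le> box (0, 0, 0) x" if "x \<in> {-R..<R}" for x
        using *[of x] that by (simp only: zero indicator_simps mult_1 order_refl)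
      moreover have "(\<integral>x. box (0, 0, 0) x \<partial>lborel) \<le>
          (\<integral>x. indicator {-R..<R} x * (\<alpha> * unif_density a b x) \<partial>lborel) + \<epsilon>"
        using \<epsilon> by (simp add: * zero del: mult_eq_0_iff)
      moreover have "box (0, 0, 0) \<in> G" using K L by (auto simp: G_def)
      ultimately show ?thesis by blast
    qed
  qed
  ultimately have "upper_brackets {-R..<R} \<epsilon> (scaled_unif_densities c) G"
    unfolding upper_brackets_def scaled_unif_densities_def by blast
  with card_G show ?thesis by blast
qed

lemma sum_brackets:
  fixes F G :: "(real \<Rightarrow> real) set" and \<epsilon> :: real
  assumes G: "upper_brackets A \<epsilon> F G" and A: "A \<in> sets borel"
    and F: "\<And>f. f \<in> F \<Longrightarrow> integrable lborel f"
  shows "\<exists>H. upper_brackets A (CARD('m) * \<epsilon>) {\<lambda>x. \<Sum>m\<in>UNIV. f m x | f :: 'm::finite \<Rightarrow> real \<Rightarrow> real. \<forall>m. f m \<in> F} H \<and>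
    card H \<le> card G ^ CARD('m)"
proof -
  define S :: "('m \<Rightarrow> real \<Rightarrow> real) \<Rightarrow> real \<Rightarrow> real" where "S \<phi> x = (\<Sum>m\<in>UNIV. \<phi> m x)" for \<phi> x
  define H where "H = S ` (UNIV \<rightarrow>\<^sub>E G)"
  have G_props: "finite G" "\<And>g. g \<in> G \<Longrightarrow> integrable lborel g" "\<And>g x. g \<in> G \<Longrightarrow> 0 \<le> g x"
    "\<And>f. f \<in> F \<Longrightarrow> \<exists>g\<in>G. (\<forall>x\<in>A. f x \<le> g x) \<and>
       (\<integral>x. g x \<partial>lborel) \<le> (\<integral>x. indicator A x * f x \<partial>lborel) + \<epsilon>"
    using G unfolding upper_brackets_def by blast+
  have fin: "finite (UNIV \<rightarrow>\<^sub>E G :: ('m \<Rightarrow> real \<Rightarrow> real) set)"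
    using G_props(1) by (intro finite_PiE) auto
  have "card H \<le> card (UNIV \<rightarrow>\<^sub>E G :: ('m \<Rightarrow> real \<Rightarrow> real) set)"
    unfolding H_def using fin by (rule card_image_le)
  also have "\<dots> = card G ^ CARD('m)" by (subst card_PiE) auto
  finally have card_H: "card H \<le> card G ^ CARD('m)" .
  have "finite H" using fin by (simp add: H_def)
  moreover have "integrable lborel g" "0 \<le> g x" if "g \<in> H" for g x
    using that G_props(2,3) by (auto simp: H_def S_def[abs_def] PiE_iff intro!: sum_nonneg)
  moreover have "\<exists>g\<in>H. (\<forall>x\<in>A. S f x \<le> g x) \<and>
      (\<integral>x. g x \<partial>lborel) \<le> (\<integral>x. indicator A x * S f x \<partial>lborel) + CARD('m) * \<epsilon>"
    if f: "\<And>m. f m \<in> F" for f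
  proof -
    have "\<exists>\<phi>. \<forall>m. \<phi> m \<in> G \<and> (\<forall>x\<in>A. f m x \<le> \<phi> m x) \<and>
        (\<integral>x. \<phi> m x \<partial>lborel) \<le> (\<integral>x. indicator A x * f m x \<partial>lborel) + \<epsilon>"
      using G_props(4)[OF f] by (intro choice) blast
    then obtain \<phi> where \<phi>: "\<And>m. \<phi> m \<in> G" "\<And>m x. x \<in> A \<Longrightarrow> f m x \<le> \<phi> m x"
      "\<And>m. (\<integral>x. \<phi> m x \<partial>lborel) \<le> (\<integral>x. indicator A x * f m x \<partial>lborel) + \<epsilon>"
      by blast
    have int: "integrable lborel (\<lambda>x. indicator A x * f m x)" for m
      using integrable_real_mult_indicator[of A lborel "f m"] A F[OF f] by (simp add: mult.commute)
    have "(\<integral>x. S \<phi> x \<partial>lborel) = (\<Sum>m\<in>UNIV. \<integral>x. \<phi> m x \<partial>lborel)"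
      unfolding S_def using \<phi>(1) G_props(2) by (intro Bochner_Integration.integral_sum) auto
    also have "\<dots> \<le> (\<Sum>m\<in>UNIV. (\<integral>x. indicator A x * f m x \<partial>lborel) + \<epsilon>)"
      using \<phi>(3) by (rule sum_mono)
    also have "\<dots> = (\<Sum>m\<in>UNIV. \<integral>x. indicator A x * f m x \<partial>lborel) + CARD('m) * \<epsilon>"
      by (simp add: sum.distrib)
    also have "(\<Sum>m\<in>UNIV. \<integral>x. indicator A x * f m x \<partial>lborel) = (\<integral>x. indicator A x * S f x \<partial>lborel)"
      using int by (subst Bochner_Integration.integral_sum[symmetric]) (auto simp: S_def sum_distrib_left)
    finally have "(\<integral>x. S \<phi> x \<partial>lborel) \<le> (\<integral>x. indicator A x * S f x \<partial>lborel) + CARD('m) * \<epsilon>" .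
    moreover have "\<forall>x\<in>A. S f x \<le> S \<phi> x"
      using \<phi>(2) by (auto simp: S_def intro: sum_mono)
    moreover have "S \<phi> \<in> H"
      unfolding H_def using \<phi>(1) by (intro image_eqI[of _ _ \<phi>]) auto
    ultimately show ?thesis by blast
  qed
  ultimately have "upper_brackets A (CARD('m) * \<epsilon>) {S f | f. \<forall>m. f m \<in> F} H"
    unfolding upper_brackets_def by blast
  with card_H show ?thesis unfolding S_def[abs_def] by blast
qed

text \<open>
  A mixture is a sum of \<open>M\<close> scaled uniform densities, whose brackets can be chosen independently of each
  other, with an excess of \<open>\<epsilon> / M\<close> for each.  Uniformity of \<open>C\<close> in \<open>c\<close> matters because \<open>c\<close> will
  depend on the sample size.
\<close>
lemma mixture_brackets:
  fixes R \<epsilon> :: real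
  assumes R: "0 < R" and \<epsilon>: "0 < \<epsilon>"
  shows "\<exists>C>0. \<forall>c. 0 < c \<longrightarrow> c \<le> 1 \<longrightarrow>
    (\<exists>G. upper_brackets {-R..<R} \<epsilon> (mix_density ` (Theta_ge c :: 'm::finite params set)) G \<and>
      real (card G) \<le> (C / c ^ 3) ^ CARD('m))"
proof -
  define e where "e = \<epsilon> / CARD('m)"
  define C where "C = (4 * R / e + 3)\<^sup>2 * ((2 * R + e) / e + 2)"
  have e: "0 < e" using \<epsilon> by (simp add: e_def)
  show ?thesis
  proof (intro exI[of _ C] conjI allI impI)
    show "0 < C" unfolding C_def using e R by (intro mult_pos_pos zero_less_power add_pos_pos) auto
    fix c :: real assume c: "0 < c" "c \<le> 1"
    obtain G where G: "upper_brackets {-R..<R} e (scaled_unif_densities c) G" "real (card G) \<le> C / c ^ 3"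
      using component_brackets[OF R e c] unfolding C_def by blast
    have "integrable lborel f" if "f \<in> scaled_unif_densities c" for f
      using that c has_bochner_integral_unif_density
      by (fastforce simp: scaled_unif_densities_def has_bochner_integral_iff)
    with sum_brackets[where 'm = 'm, OF G(1)] obtain H where
      H: "upper_brackets {-R..<R} (CARD('m) * e) {\<lambda>x. \<Sum>m\<in>UNIV. f m x | f :: 'm \<Rightarrow> real \<Rightarrow> real. \<forall>m. f m \<in> scaled_unif_densities c} H"
        "card H \<le> card G ^ CARD('m)"
      by auto
    have "mix_density ` (Theta_ge c :: 'm params set) \<subseteq>
        {\<lambda>x. \<Sum>m\<in>UNIV. f m x | f :: 'm \<Rightarrow> real \<Rightarrow> real. \<forall>m. f m \<in> scaled_unif_densities c}"
    proof
      fix f assume "f \<in> mix_density ` (Theta_ge c :: 'm params set)"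
      then obtain \<theta> :: "'m params" where \<theta>: "\<theta> \<in> Theta_ge c" "f = mix_density \<theta>" by blast
      define \<phi> where "\<phi> m x = fst (\<theta> $ m) * unif_density (fst (snd (\<theta> $ m))) (snd (snd (\<theta> $ m))) x" for m x
      have "\<theta> \<in> Theta" using \<theta> by (simp add: Theta_ge_def)
      have "\<phi> m \<in> scaled_unif_densities c" for m
      proof -
        obtain \<alpha> a b where eq: "\<theta> $ m = (\<alpha>, a, b)" by (rule prod_cases3)
        have "c \<le> b" using \<theta>(1) eq by (auto simp: Theta_ge_def dest!: spec[of _ m])
        then show ?thesis
          unfolding scaled_unif_densities_def \<phi>_def[abs_def] eq fst_conv snd_conv
          using Theta_D(1,2)[OF \<open>\<theta> \<in> Theta\<close> eq] by blast
      qed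
      moreover have "f = (\<lambda>x. \<Sum>m\<in>UNIV. \<phi> m x)"
        by (simp add: \<theta>(2) mix_density_def mixture_def[abs_def] \<phi>_def split_beta)
      ultimately show "f \<in> {\<lambda>x. \<Sum>m\<in>UNIV. f m x | f :: 'm \<Rightarrow> real \<Rightarrow> real. \<forall>m. f m \<in> scaled_unif_densities c}"
        by blast
    qed
    then have "upper_brackets {-R..<R} \<epsilon> (mix_density ` (Theta_ge c :: 'm params set)) H"
      by (rule upper_brackets_mono) (use H(1) in \<open>simp add: e_def\<close>)
    moreover have "real (card H) \<le> (C / c ^ 3) ^ CARD('m)"
    proof -
      have "real (card H) \<le> real (card G) ^ CARD('m)"
        using H(2) by (simp flip: of_nat_power)
      also have "\<dots> \<le> (C / c ^ 3) ^ CARD('m)" using G(2) by (intro power_mono) auto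
      finally show ?thesis .
    qed
    ultimately show "\<exists>G. upper_brackets {-R..<R} \<epsilon> (mix_density ` (Theta_ge c :: 'm params set)) G \<and>
        real (card G) \<le> (C / c ^ 3) ^ CARD('m)"
      by blast
  qed
qed

section \<open>Large deviations of the likelihood ratio\<close>

text \<open>
  Taking square roots before applying Markov's inequality makes the expectation of each factor at most
  \<open>\<integral> \<surd>(g f) \<le> r\<close>.  The condition \<open>0 < f (X\<^sub>i)\<close>, which holds almost surely, allows the division.
\<close>
lemma (in prob_space) likelihood_ratio_tail:
  fixes f g :: "real \<Rightarrow> real" and X :: "nat \<Rightarrow> 'a \<Rightarrow> real" and n :: nat
  assumes indep: "indep_vars (\<lambda>_. borel) X UNIV"
    and D: "\<And>i. distributed M lborel (X i) (\<lambda>x. ennreal (f x))"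
    and f: "integrable lborel f" "\<And>x. 0 \<le> f x"
    and g: "integrable lborel g" "\<And>x. 0 \<le> g x"
    and r: "affinity g f \<le> r" and \<kappa>: "0 < \<kappa>"
  defines "E \<equiv> {\<omega>\<in>space M. (\<forall>i<n. 0 < f (X i \<omega>)) \<and>
      \<kappa> * (\<Prod>i<n. f (X i \<omega>)) \<le> (\<Prod>i<n. g (X i \<omega>))}"
  shows "E \<in> events" "prob E \<le> r ^ n / sqrt \<kappa>"
proof -
  have [measurable]: "f \<in> borel_measurable borel" "g \<in> borel_measurable borel"
    using f g by auto
  have [measurable]: "X i \<in> borel_measurable M" for i
    using indep by (auto simp: indep_vars_def)
  show E: "E \<in> events"
    unfolding E_def by measurable
  have "0 \<le> affinity g f" using f g by (simp add: affinity_def)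
  then have r0: "0 \<le> r" using r by simp
  define q where "q x = sqrt (g x / f x)" for x
  have q[measurable]: "q \<in> borel_measurable borel" unfolding q_def by measurable
  have q_nonneg: "0 \<le> q x" for x using f(2) g(2) by (simp add: q_def)
  have q_mean: "(\<integral>\<^sup>+\<omega>. ennreal (q (X i \<omega>)) \<partial>M) \<le> ennreal r" for i
  proof -
    have "(\<integral>\<^sup>+\<omega>. ennreal (q (X i \<omega>)) \<partial>M) = (\<integral>\<^sup>+x. ennreal (f x) * ennreal (q x) \<partial>lborel)"
      by (subst distributed_nn_integral[OF D]) auto
    also have "\<dots> \<le> (\<integral>\<^sup>+x. ennreal (sqrt (g x * f x)) \<partial>lborel)"
    proof (intro nn_integral_mono)
      fix x
      have "f x * q x \<le> sqrt (g x * f x)"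
      proof (cases "f x = 0")
        case False
        then have "f x * q x = sqrt ((f x)\<^sup>2 * (g x / f x))"
          using f(2)[of x] by (simp only: q_def real_sqrt_mult real_sqrt_abs abs_of_nonneg)
        also have "(f x)\<^sup>2 * (g x / f x) = g x * f x"
          using False by (simp add: power2_eq_square)
        finally show ?thesis by simp
      qed simp
      then show "ennreal (f x) * ennreal (q x) \<le> ennreal (sqrt (g x * f x))"
        using f(2)[of x] q_nonneg[of x] by (simp add: ennreal_leI flip: ennreal_mult)
    qed
    also have "\<dots> = ennreal (affinity g f)"
      unfolding affinity_def using f g
      by (intro nn_integral_eq_integral integrable_sqrt_mult) auto
    also have "\<dots> \<le> ennreal r" using r by (rule ennreal_leI)
    finally show ?thesis .
  qed
  have "emeasure M E \<le> emeasure M {\<omega>\<in>space M. 1 \<le> ennreal (1 / sqrt \<kappa>) * (\<Prod>i<n. ennreal (q (X i \<omega>)))}"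
  proof (intro emeasure_mono subsetI)
    fix \<omega> assume "\<omega> \<in> E"
    then have \<omega>: "\<omega> \<in> space M" and pos: "\<And>i. i < n \<Longrightarrow> 0 < f (X i \<omega>)"
      and le: "\<kappa> * (\<Prod>i<n. f (X i \<omega>)) \<le> (\<Prod>i<n. g (X i \<omega>))"
      by (auto simp: E_def)
    have "0 < (\<Prod>i<n. f (X i \<omega>))" using pos by (intro prod_pos) auto
    then have "\<kappa> \<le> (\<Prod>i<n. g (X i \<omega>) / f (X i \<omega>))"
      using le by (simp add: prod_dividef pos_le_divide_eq)
    then have "sqrt \<kappa> \<le> sqrt (\<Prod>i<n. g (X i \<omega>) / f (X i \<omega>))" by simp
    also have "\<dots> = (\<Prod>i<n. q (X i \<omega>))"
      unfolding q_def 
      by (induction n) (simp_all only: lessThan_0 prod.empty real_sqrt_one prod.lessThan_Suc real_sqrt_mult)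
    finally have "1 \<le> 1 / sqrt \<kappa> * (\<Prod>i<n. q (X i \<omega>))" using \<kappa> by (simp add: field_simps)
    also have "ennreal \<dots> = ennreal (1 / sqrt \<kappa>) * (\<Prod>i<n. ennreal (q (X i \<omega>)))"
      using \<kappa> q_nonneg by (subst ennreal_mult) (simp_all add: prod_nonneg prod_ennreal)
    finally show "\<omega> \<in> {\<omega>\<in>space M. 1 \<le> ennreal (1 / sqrt \<kappa>) * (\<Prod>i<n. ennreal (q (X i \<omega>)))}"
      using \<omega> by (simp add: ennreal_leI)
  qed measurable
  also have "\<dots> \<le> ennreal (1 / sqrt \<kappa>) * (\<integral>\<^sup>+\<omega>. (\<Prod>i<n. ennreal (q (X i \<omega>))) * indicator (space M) \<omega> \<partial>M)"
    by (rule nn_integral_Markov_inequality) measurable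
  also have "(\<integral>\<^sup>+\<omega>. (\<Prod>i<n. ennreal (q (X i \<omega>))) * indicator (space M) \<omega> \<partial>M) =
      (\<integral>\<^sup>+\<omega>. (\<Prod>i<n. ennreal (q (X i \<omega>))) \<partial>M)"
    by (intro nn_integral_cong) simp
  also have "\<dots> = (\<Prod>i<n. \<integral>\<^sup>+\<omega>. ennreal (q (X i \<omega>)) \<partial>M)"
    by (intro indep_vars_nn_integral indep_vars_compose2[OF indep_vars_subset[OF indep]]) auto
  also have "\<dots> \<le> (\<Prod>i<n. ennreal r)" using q_mean by (intro prod_mono_ennreal)
  also have "\<dots> = ennreal (r ^ n)" using r0 by (simp add: ennreal_power)
  also have "ennreal (1 / sqrt \<kappa>) * ennreal (r ^ n) = ennreal (r ^ n / sqrt \<kappa>)"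
    using r0 \<kappa> by (simp flip: ennreal_mult)
  finally have "emeasure M E \<le> ennreal (r ^ n / sqrt \<kappa>)" by (simp add: mult_left_mono)
  then show "prob E \<le> r ^ n / sqrt \<kappa>"
    using r0 \<kappa> by (simp add: emeasure_eq_measure)
qed

text \<open>
  An upper bracket has nearly the affinity of the function that it bounds, because
  \<open>\<surd>g \<le> \<surd>f + \<surd>(g - f)\<close> and because \<open>\<integral> \<surd>((g - f) f\<^sub>0)\<close> is at most the square root of the
  excess.  Instead of the Cauchy-Schwarz inequality the proof uses the pointwise inequality of
  arithmetic and geometric means for \<open>(g - f) / \<epsilon>\<close> and \<open>\<epsilon> f\<^sub>0\<close>.
\<close>
lemma affinity_bracket_le:
  fixes f f\<^sub>0 g :: "real \<Rightarrow> real"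
  assumes f: "integrable lborel f" "\<And>x. 0 \<le> f x"
    and f\<^sub>0: "has_bochner_integral lborel f\<^sub>0 1" "\<And>x. 0 \<le> f\<^sub>0 x"
    and g: "integrable lborel g" "\<And>x. 0 \<le> g x"
    and A: "A \<in> sets borel" "\<And>x. x \<notin> A \<Longrightarrow> f\<^sub>0 x = 0" "\<And>x. x \<in> A \<Longrightarrow> f x \<le> g x"
    and excess: "(\<integral>x. g x \<partial>lborel) \<le> (\<integral>x. indicator A x * f x \<partial>lborel) + \<epsilon>\<^sup>2" and \<epsilon>: "0 < \<epsilon>"
  shows "affinity g f\<^sub>0 \<le> affinity f f\<^sub>0 + \<epsilon>"
proof -
  let ?u = "\<lambda>x. g x - indicator A x * f x"
  have int: "integrable lborel f\<^sub>0" "(\<integral>x. f\<^sub>0 x \<partial>lborel) = 1"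
    "integrable lborel (\<lambda>x. indicator A x * f x)"
    using f\<^sub>0 f A(1) integrable_real_mult_indicator[of A lborel f]
    by (auto simp: has_bochner_integral_iff mult.commute)
  have "affinity g f\<^sub>0 \<le> (\<integral>x. sqrt (f x * f\<^sub>0 x) + (?u x / \<epsilon> + \<epsilon> * f\<^sub>0 x) / 2 \<partial>lborel)"
    unfolding affinity_def
  proof (intro integral_mono)
    fix x
    show "sqrt (g x * f\<^sub>0 x) \<le> sqrt (f x * f\<^sub>0 x) + (?u x / \<epsilon> + \<epsilon> * f\<^sub>0 x) / 2"
    proof (cases "x \<in> A")
      case True
      then have le: "f x \<le> g x" by (rule A(3))
      have "sqrt (g x * f\<^sub>0 x) = sqrt (f x * f\<^sub>0 x + (g x - f x) * f\<^sub>0 x)"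
        by (simp add: algebra_simps)
      also have "\<dots> \<le> sqrt (f x * f\<^sub>0 x) + sqrt ((g x - f x) * f\<^sub>0 x)"
        using le f(2) f\<^sub>0(2) by (intro sqrt_add_le_add_sqrt mult_nonneg_nonneg) auto
      also have "sqrt ((g x - f x) * f\<^sub>0 x) = sqrt ((g x - f x) / \<epsilon> * (\<epsilon> * f\<^sub>0 x))"
        using \<epsilon> by simp
      also have "\<dots> \<le> ((g x - f x) / \<epsilon> + \<epsilon> * f\<^sub>0 x) / 2"
        using le f\<^sub>0(2) \<epsilon> by (intro arith_geo_mean_sqrt) auto
      finally show ?thesis using True by simp
    next
      case False
      then show ?thesis using A(2)[OF False] g(2)[of x] \<epsilon> by simp
    qed
  qed (use f g f\<^sub>0(2) int in \<open>auto intro!: integrable_sqrt_mult\<close>)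
  also have "\<dots> = affinity f f\<^sub>0 + (((\<integral>x. g x \<partial>lborel) - (\<integral>x. indicator A x * f x \<partial>lborel)) / \<epsilon> + \<epsilon>) / 2"
    using f g f\<^sub>0(2) int by (simp add: affinity_def integrable_sqrt_mult)
  also have "\<dots> \<le> affinity f f\<^sub>0 + (\<epsilon>\<^sup>2 / \<epsilon> + \<epsilon>) / 2"
    using excess \<epsilon> by (intro add_left_mono divide_right_mono add_right_mono) auto
  also have "\<dots> = affinity f f\<^sub>0 + \<epsilon>"
    using \<epsilon> by (simp add: power2_eq_square)
  finally show ?thesis .
qed

section \<open>Strong consistency\<close>

text \<open>
  This is where \<open>d < 1\<close> is used: \<open>n\<^sup>d = o (n)\<close>, so that half of the exponential decay of \<open>r\<^sup>n\<close>
  absorbs the first factor.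
\<close>
lemma summable_exp_powr_mult_power:
  fixes r d B :: real
  assumes r: "0 < r" "r < 1" and d: "d < 1"
  shows "summable (\<lambda>n. exp (B * real n powr d) * r ^ n)"
proof (rule summable_comparison_test_ev)
  have "(\<lambda>n. B * real n powr (d - 1)) \<longlonglongrightarrow> B * 0"
    using d by (intro tendsto_mult tendsto_const tendsto_neg_powr filterlim_real_sequentially) auto
  moreover have "0 < - ln r / 2" using r by simp
  ultimately have "\<forall>\<^sub>F n in sequentially. B * real n powr (d - 1) < - ln r / 2"
    by (intro order_tendstoD(2)) auto
  then show "\<forall>\<^sub>F n in sequentially. norm (exp (B * real n powr d) * r ^ n) \<le> (sqrt r) ^ n"
    using eventually_gt_at_top[of 0]
  proof eventually_elim
    case (elim n)
    then have "B * real n powr d = B * real n powr (d - 1) * n"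
      using powr_add[of n "d - 1" 1] by simp
    also have "\<dots> \<le> - ln r / 2 * n"
      using elim by (intro mult_right_mono) auto
    finally have "exp (B * real n powr d) * r ^ n \<le> exp (- ln r / 2 * n) * r ^ n"
      using r by (intro mult_right_mono) auto
    also have "\<dots> = (exp (- ln r / 2) * r) ^ n"
      by (simp add: power_mult_distrib mult.commute flip: exp_of_nat_mult)
    also have "exp (- ln r / 2) * r = sqrt r"
    proof -
      have "exp (- ln r / 2) * r = exp (- ln r / 2) * exp (ln r)" using r by simp
      also have "\<dots> = exp (ln r / 2)" by (simp flip: exp_add)
      also have "\<dots> = sqrt r" using r by (simp flip: ln_sqrt)
      finally show ?thesis .
    qed
    finally show ?case using r by simp
  qed
  show "summable (\<lambda>n. sqrt r ^ n)" using r by (intro summable_geometric) auto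
qed

lemma mix_density_bounded_support:
  assumes "\<theta> \<in> Theta"
  obtains R where "0 < R" "\<And>x. x \<notin> {-R..<R} \<Longrightarrow> mix_density \<theta> x = 0"
proof -
  define s where "s m = \<bar>fst (snd (\<theta> $ m))\<bar> + snd (snd (\<theta> $ m))" for m
  have s_pos: "0 < s m" for m using Theta_pos[OF assms, of m] by (simp add: s_def)
  show ?thesis
  proof (rule that[of "sum s UNIV"])
    show "0 < sum s UNIV" using s_pos by (intro sum_pos) auto
    fix x assume x: "x \<notin> {- sum s UNIV..<sum s UNIV}"
    have le: "s m \<le> sum s UNIV" for m
      using s_pos by (intro member_le_sum) (auto intro: less_imp_le)
    show "mix_density \<theta> x = 0"
      unfolding mix_density_def mixture_def
    proof (intro sum.neutral ballI)
      fix m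
      show "(case \<theta> $ m of (\<alpha>, a, b) \<Rightarrow> \<alpha> * unif_density a b x) = 0"
        using x le[of m] by (auto simp: s_def unif_density_def split: prod.splits)
    qed
  qed
qed

lemma scale_bound_tendsto_0:
  assumes "0 < d"
  shows "scale_bound c\<^sub>0 d \<longlonglongrightarrow> 0"
proof -
  have "(\<lambda>n. real n powr (- d)) \<longlonglongrightarrow> 0"
    using assms by (intro tendsto_neg_powr filterlim_real_sequentially) auto
  moreover have "\<forall>\<^sub>F n in sequentially. 0 < real n powr (- d)"
    using eventually_gt_at_top[of 0] by eventually_elim simp
  ultimately have "filterlim (\<lambda>n. inverse (real n powr (- d))) at_top sequentially"
    by (rule filterlim_inverse_at_top)
  then have "filterlim (\<lambda>n. real n powr d) at_top sequentially"
    by (simp add: powr_minus)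
  then have "((\<lambda>n. exp (- (real n powr d))) \<longlongrightarrow> 0) sequentially"
    by (intro filterlim_compose[OF exp_at_bot]) (simp add: filterlim_uminus_at_bot)
  from tendsto_mult[OF tendsto_const this] show ?thesis
    by (simp add: scale_bound_def[abs_def])
qed

lemma Theta_eventually_Theta_ge:
  fixes \<theta> :: "'m::finite params"
  assumes "\<theta> \<in> Theta" "0 < c\<^sub>0" "0 < d"
  shows "\<forall>\<^sub>F n in sequentially. \<theta> \<in> Theta_ge (scale_bound c\<^sub>0 d n)"
proof -
  have "\<forall>\<^sub>F n in sequentially. \<forall>m\<in>UNIV. scale_bound c\<^sub>0 d n < snd (snd (\<theta> $ m))"
    using Theta_pos[OF assms(1)]
    by (intro eventually_ball_finite ballI order_tendstoD(2)[OF scale_bound_tendsto_0] assms) auto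
  then show ?thesis
    by eventually_elim (use assms in \<open>auto simp: Theta_ge_def scale_bound_def split_beta intro: less_imp_le\<close>)
qed

lemma Theta_ge_antimono: "0 < c \<Longrightarrow> c \<le> c' \<Longrightarrow> Theta_ge c' \<subseteq> Theta_ge c"
  by (auto simp: Theta_ge_def split_beta intro: order_trans)

text \<open>
  If the estimate is far from the true parameters, then one of its upper brackets still has affinity at
  most \<open>r = 1 - \<eta> / 2\<close> with the true density, and it inherits from the estimate a likelihood of at
  least \<open>\<kappa>\<close> times the true one.  Such an event is excluded for large \<open>n\<close> by the tail bound, summed
  over the brackets, and by the Borel-Cantelli lemma.
\<close>
lemma eventually_mle_near_true_params:
  fixes \<Omega> :: "'w measure"
    and X :: "nat \<Rightarrow> 'w \<Rightarrow> real"
    and \<theta>\<^sub>0 :: "'m::finite params"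
    and est :: "nat \<Rightarrow> (nat \<Rightarrow> real) \<Rightarrow> 'm params"
    and c\<^sub>0 d \<kappa> :: real
  assumes "prob_space \<Omega>"
    and \<theta>\<^sub>0: "\<theta>\<^sub>0 \<in> Theta"
    and indep: "prob_space.indep_vars \<Omega> (\<lambda>_. borel) X UNIV"
    and D: "\<And>i. distributed \<Omega> lborel (X i) (\<lambda>x. ennreal (mix_density \<theta>\<^sub>0 x))"
    and minimal: "\<And>M' p. M' < CARD('m) \<Longrightarrow> is_mixture_param {..<M'::nat} p \<Longrightarrow>
           mix_density \<theta>\<^sub>0 \<noteq> mixture {..<M'} p"
    and c\<^sub>0: "0 < c\<^sub>0" and d: "0 < d" "d < 1" and \<kappa>: "0 < \<kappa>"
    and est: "\<And>n x. 1 \<le> n \<Longrightarrow> x \<in> {..<n} \<rightarrow>\<^sub>E UNIV \<Longrightarrow>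
           is_mle_upto \<kappa> (Theta_ge (scale_bound c\<^sub>0 d n)) n x (est n x)"
    and \<epsilon>: "0 < \<epsilon>"
  shows "AE \<omega> in \<Omega>. \<forall>\<^sub>F n in sequentially.
      infdist (est n (\<lambda>i\<in>{..<n}. X i \<omega>)) (true_params \<theta>\<^sub>0) < \<epsilon>"
proof -
  interpret prob_space \<Omega> by fact
  obtain \<eta> where \<eta>: "0 < \<eta>" "\<eta> \<le> 1"
    and separated: "\<And>\<theta>. \<theta> \<in> Theta \<Longrightarrow> \<epsilon> \<le> infdist \<theta> (true_params \<theta>\<^sub>0) \<Longrightarrow>
      affinity (mix_density \<theta>) (mix_density \<theta>\<^sub>0) \<le> 1 - \<eta>"
    by (rule affinity_separation[of \<theta>\<^sub>0 \<epsilon>, OF \<theta>\<^sub>0 minimal \<epsilon>]) (assumption | rule that)+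
  obtain R where R: "0 < R" and supp: "\<And>x. x \<notin> {-R..<R} \<Longrightarrow> mix_density \<theta>\<^sub>0 x = 0"
    by (rule mix_density_bounded_support[OF \<theta>\<^sub>0]) (rule that)
  have "0 < (\<eta> / 2)\<^sup>2" using \<eta> by simp
  obtain C where C: "0 < C" and brackets: "\<And>c. 0 < c \<Longrightarrow> c \<le> 1 \<Longrightarrow>
      \<exists>G. upper_brackets {-R..<R} ((\<eta> / 2)\<^sup>2) (mix_density ` (Theta_ge c :: 'm params set)) G \<and>
        real (card G) \<le> (C / c ^ 3) ^ CARD('m)"
    using mixture_brackets[where 'm = 'm, OF R \<open>0 < (\<eta> / 2)\<^sup>2\<close>] by blast
  \<comment> \<open>The brackets require a bound of at most \<open>1\<close>.\<close>
  define c where "c n = min 1 c\<^sub>0 * exp (- (real n powr d))" for n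
  have c: "0 < c n" "c n \<le> 1" "c n \<le> scale_bound c\<^sub>0 d n" for n
    using c\<^sub>0 by (auto simp: c_def scale_bound_def intro: mult_le_one)
  obtain G where "\<And>n. upper_brackets {-R..<R} ((\<eta> / 2)\<^sup>2) (mix_density ` (Theta_ge (c n) :: 'm params set)) (G n)"
    and card_G: "\<And>n. real (card (G n)) \<le> (C / c n ^ 3) ^ CARD('m)"
    using brackets[OF c(1,2)] by metis
  then have G: "\<And>n. finite (G n)" "\<And>n g. g \<in> G n \<Longrightarrow> integrable lborel g" "\<And>n g x. g \<in> G n \<Longrightarrow> 0 \<le> g x"
    "\<And>n \<theta>. \<theta> \<in> (Theta_ge (c n) :: 'm params set) \<Longrightarrow>
        \<exists>g\<in>G n. (\<forall>x\<in>{-R..<R}. mix_density \<theta> x \<le> g x) \<and>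
          (\<integral>x. g x \<partial>lborel) \<le> (\<integral>x. indicator {-R..<R} x * mix_density \<theta> x \<partial>lborel) + (\<eta> / 2)\<^sup>2"
    unfolding upper_brackets_def by blast+
  define r where "r = 1 - \<eta> / 2"
  have r: "0 < r" "r < 1" using \<eta> by (auto simp: r_def)
  \<comment> \<open>Every distant parameter in \<open>Theta_ge (c n)\<close> has a bracket among these.\<close>
  define H where "H n = {g \<in> G n. affinity g (mix_density \<theta>\<^sub>0) \<le> r}" for n
  have H: "finite (H n)" "card (H n) \<le> card (G n)" for n
    using G(1) by (auto simp: H_def intro: card_mono)
  define E where "E n g = {\<omega>\<in>space \<Omega>. (\<forall>i<n. 0 < mix_density \<theta>\<^sub>0 (X i \<omega>)) \<and>
      \<kappa> * (\<Prod>i<n. mix_density \<theta>\<^sub>0 (X i \<omega>)) \<le> (\<Prod>i<n. g (X i \<omega>))}" for n g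
  define bad where "bad n = (\<Union>g\<in>H n. E n g)" for n
  have f\<^sub>0: "integrable lborel (mix_density \<theta>\<^sub>0)" "\<And>x. 0 \<le> mix_density \<theta>\<^sub>0 x"
    using has_bochner_integral_mix_density[OF \<theta>\<^sub>0] mix_density_nonneg[OF \<theta>\<^sub>0]
    by (auto simp: has_bochner_integral_iff)
  have E: "E n g \<in> events" "prob (E n g) \<le> r ^ n / sqrt \<kappa>" if "g \<in> H n" for n g
  proof -
    have g: "integrable lborel g" "\<And>x. 0 \<le> g x" "affinity g (mix_density \<theta>\<^sub>0) \<le> r"
      using that G(2,3)[of g n] by (auto simp: H_def)
    show "E n g \<in> events" "prob (E n g) \<le> r ^ n / sqrt \<kappa>"
      unfolding E_def by (rule likelihood_ratio_tail[OF indep D f\<^sub>0 g \<kappa>])+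
  qed
  have bad_event: "bad n \<in> events" for n
    unfolding bad_def using E(1) H(1) by (intro sets.finite_UN) auto
  define A where "A = (C / min 1 c\<^sub>0 ^ 3) ^ CARD('m)"
  define B where "B = 3 * real CARD('m)"
  have bad_prob: "prob (bad n) \<le> A / sqrt \<kappa> * (exp (B * real n powr d) * r ^ n)" for n
  proof -
    have "prob (bad n) \<le> (\<Sum>g\<in>H n. prob (E n g))"
      unfolding bad_def using H(1) E(1) by (intro finite_measure_subadditive_finite) auto
    also have "\<dots> \<le> (\<Sum>g\<in>H n. r ^ n / sqrt \<kappa>)"
      using E(2) by (intro sum_mono) auto
    also have "\<dots> = real (card (H n)) * (r ^ n / sqrt \<kappa>)" by simp
    also have "\<dots> \<le> (C / c n ^ 3) ^ CARD('m) * (r ^ n / sqrt \<kappa>)"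
      using H(2)[of n] card_G[of n] r \<kappa> by (intro mult_right_mono) auto
    also have "(C / c n ^ 3) ^ CARD('m) = A * exp (B * real n powr d)"
    proof -
      have "C / c n ^ 3 = C / min 1 c\<^sub>0 ^ 3 * exp (3 * real n powr d)"
        by (simp add: c_def power_mult_distrib exp_minus power_inverse divide_inverse flip: exp_of_nat_mult)
      then show ?thesis
        by (simp only: A_def B_def power_mult_distrib) (simp add: mult_ac flip: exp_of_nat_mult)
    qed
    finally show ?thesis by (simp add: mult_ac)
  qed
  have "summable (\<lambda>n. prob (bad n))"
  proof (rule summable_comparison_test')
    show "summable (\<lambda>n. A / sqrt \<kappa> * (exp (B * real n powr d) * r ^ n))"
      by (intro summable_mult summable_exp_powr_mult_power r d)
  qed (use bad_prob in auto)
  then have "AE \<omega> in \<Omega>. \<forall>\<^sub>F n in sequentially. \<omega> \<in> space \<Omega> - bad n"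
    using bad_event by (intro borel_cantelli_AE1) (auto simp: less_top[symmetric])
  moreover have "AE \<omega> in \<Omega>. \<forall>i. 0 < mix_density \<theta>\<^sub>0 (X i \<omega>)"
  proof (unfold AE_all_countable, intro allI)
    fix i
    show "AE \<omega> in \<Omega>. 0 < mix_density \<theta>\<^sub>0 (X i \<omega>)"
      by (subst distributed_AE2[OF D]) auto
  qed
  ultimately show ?thesis
  proof eventually_elim
    case (elim \<omega>)
    show ?case
      using elim(1) eventually_ge_at_top[of 1] Theta_eventually_Theta_ge[OF \<theta>\<^sub>0 c\<^sub>0 d(1)]
    proof eventually_elim
      case (elim n)
      define x where "x = (\<lambda>i\<in>{..<n}. X i \<omega>)"
      have lik: "likelihood n x \<theta> = (\<Prod>i<n. mix_density \<theta> (X i \<omega>))" for \<theta> :: "'m params"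
        by (simp add: likelihood_def x_def)
      have mle: "est n x \<in> Theta_ge (scale_bound c\<^sub>0 d n)"
        "\<kappa> * likelihood n x \<theta>\<^sub>0 \<le> likelihood n x (est n x)"
        using est[OF elim(2), of x] elim(3) by (auto simp: is_mle_upto_def x_def)
      have est_c: "est n x \<in> Theta_ge (c n)"
        using mle(1) Theta_ge_antimono[OF c(1,3)[of n]] by blast
      then have est_Theta: "est n x \<in> Theta"
        by (simp add: Theta_ge_def)
      have "infdist (est n x) (true_params \<theta>\<^sub>0) < \<epsilon>"
      proof (rule ccontr)
        assume "\<not> ?thesis"
        then have far: "affinity (mix_density (est n x)) (mix_density \<theta>\<^sub>0) \<le> 1 - \<eta>"
          using separated[OF est_Theta] by simp
        obtain g where g: "g \<in> G n" "\<And>x'. x' \<in> {-R..<R} \<Longrightarrow> mix_density (est n x) x' \<le> g x'"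
          "(\<integral>x. g x \<partial>lborel) \<le> (\<integral>x'. indicator {-R..<R} x' * mix_density (est n x) x' \<partial>lborel) + (\<eta> / 2)\<^sup>2"
          using G(4)[OF est_c] by blast
        have "affinity g (mix_density \<theta>\<^sub>0) \<le> affinity (mix_density (est n x)) (mix_density \<theta>\<^sub>0) + \<eta> / 2"
          using g(2,3) G(2,3)[OF g(1)] supp \<eta>(1) has_bochner_integral_mix_density[OF est_Theta]
            mix_density_nonneg[OF est_Theta] has_bochner_integral_mix_density[OF \<theta>\<^sub>0] f\<^sub>0(2)
          by (intro affinity_bracket_le[where A = "{-R..<R}"]) (auto simp: has_bochner_integral_iff)
        with far have "g \<in> H n" using g(1) by (simp add: H_def r_def)
        have pos: "0 < mix_density \<theta>\<^sub>0 (X i \<omega>)" for i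
          using \<open>\<forall>i. 0 < mix_density \<theta>\<^sub>0 (X i \<omega>)\<close> by blast
        have "X i \<omega> \<in> {-R..<R}" for i
          using supp[of "X i \<omega>"] pos[of i] by force
        then have "likelihood n x (est n x) \<le> (\<Prod>i<n. g (X i \<omega>))"
          unfolding lik using g(2) mix_density_nonneg[OF est_Theta] by (intro prod_mono) auto
        with mle(2) have "\<kappa> * (\<Prod>i<n. mix_density \<theta>\<^sub>0 (X i \<omega>)) \<le> (\<Prod>i<n. g (X i \<omega>))"
          unfolding lik by linarith
        with pos elim(1) have "\<omega> \<in> E n g" by (simp add: E_def)
        with \<open>g \<in> H n\<close> elim(1) show False by (auto simp: bad_def)
      qed
      then show ?case by (simp add: x_def)
    qed
  qed
qed

theorem theorem3p1:
  fixes \<Omega> :: "'w measure"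
    and X :: "nat \<Rightarrow> 'w \<Rightarrow> real"
    and \<theta>\<^sub>0 :: "'m::finite params"
    and est :: "nat \<Rightarrow> (nat \<Rightarrow> real) \<Rightarrow> 'm params"
    and c\<^sub>0 d \<kappa> :: real
  assumes "prob_space \<Omega>"
    and "\<theta>\<^sub>0 \<in> Theta"
    and "prob_space.indep_vars \<Omega> (\<lambda>_. borel) X UNIV"
    and "\<And>i. distributed \<Omega> lborel (X i) (\<lambda>x. ennreal (mix_density \<theta>\<^sub>0 x))"
    and "\<And>M' p. M' < CARD('m) \<Longrightarrow> is_mixture_param {..<M'::nat} p \<Longrightarrow>
           mix_density \<theta>\<^sub>0 \<noteq> mixture {..<M'} p"
    and "0 < c\<^sub>0" and "0 < d" and "d < 1"
    and "0 < \<kappa>" and "\<kappa> \<le> 1"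
    and "\<And>n x. 1 \<le> n \<Longrightarrow> x \<in> {..<n} \<rightarrow>\<^sub>E UNIV \<Longrightarrow>
           is_mle_upto \<kappa> (Theta_ge (scale_bound c\<^sub>0 d n)) n x (est n x)"
  shows "AE \<omega> in \<Omega>.
           (\<lambda>n. infdist (est n (\<lambda>i\<in>{..<n}. X i \<omega>)) (true_params \<theta>\<^sub>0)) \<longlonglongrightarrow> 0"
proof -
  have "AE \<omega> in \<Omega>. \<forall>j. \<forall>\<^sub>F n in sequentially.
      infdist (est n (\<lambda>i\<in>{..<n}. X i \<omega>)) (true_params \<theta>\<^sub>0) < 1 / real (Suc j)"
    unfolding AE_all_countable
    by (intro allI eventually_mle_near_true_params[OF assms(1-9) assms(11)]) auto
  then show ?thesis
  proof eventually_elim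
    case (elim \<omega>)
    show ?case
    proof (rule order_tendstoI)
      fix e :: real assume "e < 0"
      then show "\<forall>\<^sub>F n in sequentially. e < infdist (est n (\<lambda>i\<in>{..<n}. X i \<omega>)) (true_params \<theta>\<^sub>0)"
        by (intro always_eventually allI) (rule less_le_trans[OF _ infdist_nonneg])
    next
      fix e :: real assume "0 < e"
      then obtain j where "1 / real (Suc j) < e" using nat_approx_posE by blast
      with elim[rule_format, of j]
      show "\<forall>\<^sub>F n in sequentially. infdist (est n (\<lambda>i\<in>{..<n}. X i \<omega>)) (true_params \<theta>\<^sub>0) < e"
        by (auto elim!: eventually_mono)
    qed
  qed
qed

end
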